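(* Let $G$ be the standard normal cumulative distribution function (with $G^{-1}(0)=-\infty$, $G^{-1}(1)=+\infty$), let $\alpha=0.975$ and $\beta=G^{-1}(\alpha)\approx1.96$. Let data be normally distributed with unit variance and unknown mean $h\in\mathbb R$. The frequentist hypothesis testing method violates the criteria Complementarity, Inclusion, Intention, Conjunction and Disjunction, as follows. (1) Complementarity. Suppose $h\in\{-\beta,+\beta\}$ and a single $x\sim N(h,1)$ is observed. The families $C_\eta=[G^{-1}(\eta)-\beta,+\infty)$ and $C'_\eta=(-\infty,G^{-1}(1-\eta)+\beta]$ (intersected with $\mathbb R$), $\eta\in[0,1]$, are valid, uniformly optimal nested families of critical regions for the null hypotheses $\{-\beta\}$ and $\{+\beta\}$ respectively. When $x=0$, the first gives frequentist confidence $\alpha$ that $h=+\beta$ and the second gives frequentist confidence $\alpha$ that $h=-\beta$. (2) Inclusion. Let $H_0=\{h\le 0\}$, $H_1=\{h>0\}$, $H_0'=\{0\}$, $H_1'=\{h\ne0\}\supset H_1$, and observe a single $x\sim N(h,1)$. Take the standard critical regions $C_\eta=[G^{-1}(\eta),+\infty)$ for $H_0$ and $C'_\eta=(-\infty,G^{-1}(\tfrac{1-\eta}{2})]\cup[G^{-1}(1-\tfrac{1-\eta}{2}),+\infty)$ for $H_0'$ (intersected with $\mathbb R$). When $x=\beta$, the first gives frequentist confidence $\alpha=0.975$ that $h\in H_1$, while the second gives the strictly smaller frequentist confidence $0.95$ that $h\in H_1'$. (3) Intention. Let $H_0=\{h\le 0\}$ and let $x_1,x_2$ be independent $N(h,1)$.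 Under plan $D$ (collect $x_1$ only, and conclude that $h>0$ iff $x_1\ge\beta$), the critical region $\{x_1\ge\beta\}$ has frequentist confidence level $\eta=\alpha$. Under plan $D'$ (collect $x_1$; stop and conclude that $h>0$ if $x_1\ge\beta$; otherwise collect $x_2$ and conclude that $h>0$ iff $x_2\ge\beta$) the critical region $\{(x_1\ge\beta)\text{ or }(x_1<\beta\text{ and }x_2\ge\beta)\}$ has frequentist confidence level $\eta=1-(1-\alpha+\alpha(1-\alpha))\approx0.9506<\alpha$. Hence on observing $x_1=\beta$, when data collection stops with the same data under both plans, the frequentist confidence that $h>0$ is $\alpha$ under $D$ but $\approx0.9506$ under $D'$. (4) Conjunction. Let $x_1\sim N(h_1,1)$ and $x_2\sim N(h_2,1)$ be independent, and suppose $x_1=x_2=\beta$ is observed, so that one has frequentist confidence $\alpha$ that $h_n>0$ for each $n=1,2$ separately. For the null hypothesis $H_0=\{(h_1,h_2):h_1\le0\text{ or }h_2\le0\}$, with alternative $H_1=\{(h_1,h_2):h_1>0,\ h_2>0\}$, the corresponding uniformly optimal critical region of maximal frequentist confidence for this data is $C=\{(x_1,x_2):x_1\ge\beta,\ x_2\ge\beta\}$. For $h\in H_0$ the supremum of $P((x_1,x_2)\in C|h)$ is approached as $h\to(+\infty,0)$, and $\sup_{h\in H_0}P((x_1,x_2)\in C|h)=1-\alpha$, so that one has frequentist confidence $\alpha$ that both $h_1>0$ and $h_2>0$: one is equally sure that both alternatives hold as that either one alone does. (5) Disjunction. With independent $x_n\sim N(h_n,1)$, $n=1,2$, and $x_1=x_2=\beta$,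 the standard regions $C_{n,\eta}=(G^{-1}(\eta),+\infty)$ give frequentist confidence $\alpha$ that $h_n>0$ for each $n$ separately. For the null hypothesis $\{(h_1,h_2):h_1\le0,\ h_2\le0\}$, the standard family of regions $C_{\zeta(\eta)}=\{(x_1,x_2): x_1>G^{-1}(\eta)\text{ or }x_2>G^{-1}(\eta)\}$, where $\zeta(\eta)$ is the frequentist confidence level of the region, has $\zeta(\eta)=\eta^2$, and gives frequentist confidence only $\alpha^2<\alpha$ that at least one of $h_1>0$, $h_2>0$ holds.
   Context: For a null hypothesis $H_0$ about the unknown $h$ and data $x\in X$, a valid nested family of critical regions is a family $(C_\eta)_{\eta\in[0,1]}$ of (measurable) subsets of $X$ with $\eta_1\le\eta_2\Rightarrow C_{\eta_1}\supseteq C_{\eta_2}$ and $P(x\in C_\eta|h)\le 1-\eta$ for all $\eta\in[0,1]$ and all $h\in H_0$. The frequentist confidence that the alternative $H_1$ (the complement of $H_0$) holds, given observed $x$, is $c=\sup(\{\eta\in[0,1]:x\in C_\eta\}\cup\{0\})$. The frequentist confidence level of a single region $C$ is $\eta=1-\sup_{h\in H_0}P(x\in C|h)$. A critical region $C_\eta$ is uniformly optimal if for each $C'\subseteq X$ with $P(x\in C'|h)\le1-\eta$ for all $h\in H_0$, and each $h\in H_1$, one has $P(x\in C_\eta|h)\ge P(x\in C'|h)$; a family is uniformly optimal if each of its regions is. The criteria being violated are requirements on a notion of being "$\eta$-sure" (here: frequentist confidence $\eta$). Complementarity: if data make one $\eta$-sure of $H_1$ with $\eta$ near 1, then after exchanging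 the roles of $H_0$ and $H_1$ the same method and data should make one $\eta'$-sure of the old $H_0$ only for $\eta'$ near 0, ideally $\eta'$ being at most $1-\eta$. Inclusion: if $H_1\subseteq H_1'$, one should not be more sure of $H_1$ than of $H_1'$. Intention: the inference from data $x_1$ should not depend on whether one intended perhaps, depending only on the value of $x_1$, to collect further data on the same system. Conjunction: if for each of $N>1$ independent and identical systems one is exactly $\eta$-sure ($0<\eta<1$) that its alternative holds, one should be strictly less than $\eta$-sure that all the alternatives hold. Disjunction: if for each of $N>1$ independent systems, identical apart from the values of their unknowns, one is exactly $\eta$-sure ($0<\eta<1$) that its alternative holds, one should be strictly more than $\eta$-sure that at least one of the alternatives holds.
   Formalization: In (4), C is not uniformly optimal among all measurable regions (adding a small square I×I, I in [0,β), keeps the level and raises power). Its optimality and maximal confidence are instead proved among regions that contain, with each point, all coordinatewise larger points. *)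

theory Defs
  imports "HOL-Probability.Probability"
begin

section \<open>Frequentist hypothesis tests\<close>

text \<open>
  A statistical model is a family \<open>P\<close> of probability measures on the data space, indexed by the
  unknown; \<open>\<Theta>\<close> is the set of possible values of the unknown, \<open>H0 \<subseteq> \<Theta>\<close> the null hypothesis
  and \<open>\<Theta> - H0\<close> the alternative.
\<close>

definition critical_region ::
  "'h set \<Rightarrow> ('h \<Rightarrow> 'x measure) \<Rightarrow> 'h set \<Rightarrow> real \<Rightarrow> 'x set \<Rightarrow> bool" where
  "critical_region \<Theta> P H0 \<eta> C \<longleftrightarrow>
     (\<forall>h\<in>\<Theta>. C \<in> sets (P h)) \<and> (\<forall>h\<in>H0. measure (P h) C \<le> 1 - \<eta>)"

definition valid_nested_family ::
  "'h set \<Rightarrow> ('h \<Rightarrow> 'x measure) \<Rightarrow> 'h set \<Rightarrow> (real \<Rightarrow> 'x set) \<Rightarrow> bool" where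
  "valid_nested_family \<Theta> P H0 C \<longleftrightarrow>
     (\<forall>\<eta>\<in>{0..1}. critical_region \<Theta> P H0 \<eta> (C \<eta>)) \<and>
     (\<forall>\<eta>1\<in>{0..1}. \<forall>\<eta>2\<in>{0..1}. \<eta>1 \<le> \<eta>2 \<longrightarrow> C \<eta>2 \<subseteq> C \<eta>1)"

definition frequentist_confidence :: "(real \<Rightarrow> 'x set) \<Rightarrow> 'x \<Rightarrow> real" where
  "frequentist_confidence C x = Sup ({\<eta>\<in>{0..1}. x \<in> C \<eta>} \<union> {0})"

definition confidence_level :: "('h \<Rightarrow> 'x measure) \<Rightarrow> 'h set \<Rightarrow> 'x set \<Rightarrow> real" where
  "confidence_level P H0 C = 1 - (SUP h\<in>H0. measure (P h) C)"

text \<open>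
  Uniform optimality relative to a class \<open>K\<close> of competing regions; the unrestricted notion is the
  case \<open>K = UNIV\<close>.
\<close>

definition uniformly_optimal_within ::
  "'x set set \<Rightarrow> 'h set \<Rightarrow> ('h \<Rightarrow> 'x measure) \<Rightarrow> 'h set \<Rightarrow> real \<Rightarrow> 'x set \<Rightarrow> bool" where
  "uniformly_optimal_within K \<Theta> P H0 \<eta> C \<longleftrightarrow>
     C \<in> K \<and> critical_region \<Theta> P H0 \<eta> C \<and>
     (\<forall>C'\<in>K. critical_region \<Theta> P H0 \<eta> C' \<longrightarrow>
        (\<forall>h\<in>\<Theta> - H0. measure (P h) C' \<le> measure (P h) C))"

abbreviation uniformly_optimal ::
  "'h set \<Rightarrow> ('h \<Rightarrow> 'x measure) \<Rightarrow> 'h set \<Rightarrow> real \<Rightarrow> 'x set \<Rightarrow> bool" where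
  "uniformly_optimal \<equiv> uniformly_optimal_within UNIV"

definition uniformly_optimal_family ::
  "'h set \<Rightarrow> ('h \<Rightarrow> 'x measure) \<Rightarrow> 'h set \<Rightarrow> (real \<Rightarrow> 'x set) \<Rightarrow> bool" where
  "uniformly_optimal_family \<Theta> P H0 C \<longleftrightarrow> (\<forall>\<eta>\<in>{0..1}. uniformly_optimal \<Theta> P H0 \<eta> (C \<eta>))"

text \<open>
  A test given by one region \<open>C\<close> only, seen as a nested family: the confidence of an observation is
  the level of \<open>C\<close> if it lies in \<open>C\<close>, and \<open>0\<close> otherwise.
\<close>

definition single_region_family ::
  "('h \<Rightarrow> 'x measure) \<Rightarrow> 'h set \<Rightarrow> 'x set \<Rightarrow> real \<Rightarrow> 'x set" where
  "single_region_family P H0 C \<eta> =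
     (if \<eta> \<le> 0 then UNIV else if \<eta> \<le> confidence_level P H0 C then C else {})"

section \<open>Normal data\<close>

definition normal1 :: "real \<Rightarrow> real measure" where
  "normal1 h = density lborel (normal_density h 1)"

text \<open>The joint law of independent \<open>x1\<close>, \<open>x2\<close> with means \<open>fst h\<close>, \<open>snd h\<close>.\<close>

definition normal2 :: "real \<times> real \<Rightarrow> (real \<times> real) measure" where
  "normal2 h = normal1 (fst h) \<Otimes>\<^sub>M normal1 (snd h)"

definition G :: "real \<Rightarrow> real" where
  "G = cdf (normal1 0)"

text \<open>Only used for arguments in \<open>{0..1}\<close>.\<close>

definition G_inv :: "real \<Rightarrow> ereal" where
  "G_inv p = (if p = 0 then -\<infinity> else if p = 1 then \<infinity> else ereal (the_inv G p))"

text \<open>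
  Among all measurable regions, \<open>{x1 \<ge> b, x2 \<ge> b}\<close> is not uniformly optimal for the null hypothesis
  \<open>h1 \<le> 0 \<or> h2 \<le> 0\<close> when \<open>b > 0\<close>: adding a square \<open>I \<times> I\<close>, where \<open>I \<subseteq> {0..<b}\<close> is a
  nondegenerate interval of probability at most \<open>1 - G b\<close> under mean \<open>0\<close>, keeps the level and
  increases the power everywhere. Its optimality refers to the regions that contain, with each
  observation, all coordinatewise larger ones.
\<close>

definition monotone_regions :: "(real \<times> real) set set" where
  "monotone_regions =
     {A. \<forall>x\<in>A. \<forall>y. fst x \<le> fst y \<and> snd x \<le> snd y \<longrightarrow> y \<in> A}"

section \<open>Sampling plans\<close>

text \<open>
  The list of values actually collected, as a function of the values \<open>(x1, x2)\<close> that would be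
  obtained if both were collected, and the conclusion (that \<open>h > 0\<close>) drawn from that list.
\<close>

definition data_D :: "real \<times> real \<Rightarrow> real list" where
  "data_D x = [fst x]"

definition data_D' :: "real \<Rightarrow> real \<times> real \<Rightarrow> real list" where
  "data_D' b x = (if fst x \<ge> b then [fst x] else [fst x, snd x])"

definition concludes_D :: "real \<Rightarrow> real list \<Rightarrow> bool" where
  "concludes_D b xs \<longleftrightarrow> xs ! 0 \<ge> b"

definition concludes_D' :: "real \<Rightarrow> real list \<Rightarrow> bool" where
  "concludes_D' b xs \<longleftrightarrow> xs ! 0 \<ge> b \<or> (length xs = 2 \<and> xs ! 1 \<ge> b)"

end

theory Submission
  imports Defs
begin

text \<open>
  Each family of critical regions in this theory has, on \<open>{0..1}\<close>, the form
  \<open>C \<eta> = {x. \<eta> \<le> V x}\<close> or \<open>C \<eta> = {x. \<eta> < V x}\<close>, or consists of a single region. In the first two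
  forms the frequentist confidence at \<open>x\<close> is \<open>V x\<close>, nestedness is automatic, and validity says that
  under the null hypothesis \<open>V\<close> is stochastically at most uniform. Applying \<open>G\<close> to both sides of the
  inequalities with quantiles gives the functions \<open>V\<close>:

  \<^item> \<open>G (\<beta> + x)\<close> and \<open>G (\<beta> - x)\<close> for the two simple hypotheses; they agree at \<open>x = 0\<close>;
  \<^item> \<open>G x\<close> for the one-sided and \<open>\<bar>2 * G x - 1\<bar>\<close> for the two-sided test; the second is smaller when
    \<open>x > 0\<close>, because half of the size is spent on the other tail;
  \<^item> \<open>min (G x1) (G x2)\<close> for the conjunction, which at \<open>x1 = x2\<close> is no smaller than either entry;
  \<^item> \<open>(max (G x1) (G x2))\<^sup>2\<close> for the disjunction, which at \<open>x1 = x2\<close> is smaller than either entry.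

  Validity of these families reduces to the probability integral transform (\<open>measure_normal1_G\<close>): \<open>G (x - h)\<close> is
  uniform under mean \<open>h\<close>. The single regions of the two sampling plans have level \<open>G \<beta>\<close> and
  \<open>(G \<beta>)\<^sup>2\<close>, because the plan with optional continuation offers two independent chances of a false
  rejection.

  Optimality of the half-line regions is the Neyman-Pearson lemma (\<open>neyman_pearson\<close>), since the
  likelihood ratio of two normal laws is monotone. Optimality of the quadrant among monotone regions
  is simpler (\<open>monotone_region_subset\<close>): letting one mean tend to infinity shows that every monotone
  region of the required size lies inside the quadrant.

  The value of \<open>\<beta>\<close> follows from the alternating Taylor bounds of the exponential, integrated
  term by term (\<open>G_series_bounds\<close>), and bounds on \<open>pi\<close>.
\<close>

section \<open>The normal distribution function and its quantiles\<close>

lemma sets_normal1 [simp, measurable_cong]: "sets (normal1 h) = sets borel"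
  by (simp add: normal1_def)

lemma space_normal1 [simp]: "space (normal1 h) = UNIV"
  by (simp add: normal1_def)

lemma prob_space_normal1: "prob_space (normal1 h)"
  unfolding normal1_def by (rule prob_space_normal_density) simp

interpretation normal1: prob_space "normal1 h" for h
  by (rule prob_space_normal1)

interpretation std: real_distribution "normal1 0"
  by standard simp

text \<open>
  The signs \<open>s = \<plusminus>1\<close> cover translation, which reduces every mean to \<open>0\<close>, and reflection, which
  yields \<open>G (- x) = 1 - G x\<close>.
\<close>

lemma distr_normal1_affine:
  assumes "\<bar>s\<bar> = 1"
  shows "distr (normal1 m) borel (\<lambda>x. c + s * x) = normal1 (c + s * m)"
proof -
  have "distributed (normal1 m) lborel (\<lambda>x. x) (normal_density m 1)"
    unfolding distributed_def
    by (auto simp: normal1_def intro!: distr_id2)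
  then have "distributed (normal1 m) lborel (\<lambda>x. c + s * x) (normal_density (c + s * m) (\<bar>s\<bar> * 1))"
    by (rule normal1.normal_density_affine) (use assms in auto)
  then have "distr (normal1 m) lborel (\<lambda>x. c + s * x) = normal1 (c + s * m)"
    using assms by (simp add: distributed_def normal1_def)
  then show ?thesis
    by (simp cong: distr_cong)
qed

lemma G_eq: "G x = measure (normal1 0) {..x}"
  by (simp add: G_def cdf_def)

lemma measure_normal1_atMost: "measure (normal1 h) {..x} = G (x - h)"
proof -
  have "measure (normal1 h) {..x} = measure (distr (normal1 0) borel (\<lambda>x. h + 1 * x)) {..x}"
    by (subst distr_normal1_affine) simp_all
  also have "\<dots> = measure (normal1 0) {..x - h}"
    by (subst measure_distr) (auto intro!: arg_cong[where f = "measure (normal1 0)"])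
  finally show ?thesis by (simp add: G_eq)
qed

text \<open>
  The density vanishes nowhere. Hence the law has no atoms, which makes \<open>G\<close> continuous, and it
  charges every interval, which makes \<open>G\<close> strictly increasing.
\<close>

lemma normal1_null_iff:
  "A \<in> null_sets (normal1 h) \<longleftrightarrow> A \<in> null_sets lborel"
proof -
  have "normal_density h 1 x \<noteq> 0" for x
    using normal_density_pos[of 1 h x] by simp
  then show ?thesis
    unfolding normal1_def
    by (auto simp: null_sets_density_iff AE_iff_null_sets intro: AE_not_in)
qed

lemma measure_normal1_singleton: "measure (normal1 h) {x} = 0"
  using normal1_null_iff[of "{x}" h] by (simp add: measure_def null_sets_def)

lemma measure_normal1_lessThan: "measure (normal1 h) {..<x} = G (x - h)"
proof -
  have "measure (normal1 h) {..x} = measure (normal1 h) {..<x} + measure (normal1 h) {x}"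
    by (subst normal1.finite_measure_Union[symmetric])
       (auto intro!: arg_cong[where f = "measure (normal1 h)"])
  then show ?thesis
    by (simp add: measure_normal1_atMost measure_normal1_singleton)
qed

lemma isCont_G: "isCont G x"
  unfolding G_def by (simp add: std.isCont_cdf measure_normal1_singleton)

lemma G_strict_mono: "strict_mono G"
proof
  fix a b :: real
  assume "a < b"
  then have "{a<..b} \<notin> null_sets (normal1 0)"
    unfolding normal1_null_iff by (simp add: null_sets_def)
  then have "0 < measure (normal1 0) {a<..b}"
    by (simp add: null_sets_def normal1.emeasure_eq_measure zero_less_measure_iff)
  then show "G a < G b"
    using std.cdf_diff_eq[OF \<open>a < b\<close>] by (simp add: G_def)
qed

lemma G_less_iff [simp]: "G x < G y \<longleftrightarrow> x < y"
  using G_strict_mono by (rule strict_mono_less)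

lemma G_le_iff [simp]: "G x \<le> G y \<longleftrightarrow> x \<le> y"
  using G_strict_mono by (rule strict_mono_less_eq)

lemma G_pos [simp]: "0 < G x"
  using std.cdf_nonneg[of "x - 1"] G_less_iff[of "x - 1" x] by (simp add: G_def del: G_less_iff)

lemma G_less_1 [simp]: "G x < 1"
  using std.cdf_bounded_prob[of "x + 1"] G_less_iff[of x "x + 1"] by (simp add: G_def del: G_less_iff)

lemma G_minus: "G (- x) = 1 - G x"
proof -
  have "G (- x) = measure (distr (normal1 0) borel (\<lambda>x. 0 + (-1) * x)) {..- x}"
    by (subst distr_normal1_affine) (simp_all add: G_eq)
  also have "\<dots> = measure (normal1 0) (UNIV - {..<x})"
    by (subst measure_distr) (auto intro!: arg_cong[where f = "measure (normal1 0)"])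
  also have "\<dots> = 1 - G x"
    using normal1.prob_compl[of "{..<x}" 0] by (simp add: measure_normal1_lessThan)
  finally show ?thesis .
qed

lemma G_0: "G 0 = 1 / 2"
  using G_minus[of 0] by simp

lemma G_lim_top: "(G \<longlongrightarrow> 1) at_top"
  unfolding G_def by (rule std.cdf_lim_at_top_prob)

lemma G_lim_bot: "(G \<longlongrightarrow> 0) at_bot"
  unfolding G_def by (rule std.cdf_lim_at_bot)

lemma G_surj:
  assumes "0 < p" "p < 1"
  shows "\<exists>x. G x = p"
proof -
  have "\<forall>\<^sub>F x in at_bot. G x < p"
    using G_lim_bot assms(1) by (auto simp: order_tendsto_iff)
  then obtain a where a: "G a < p"
    by (meson eventually_at_bot_linorder order_refl)
  have "\<forall>\<^sub>F x in at_top. p < G x"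
    using G_lim_top assms(2) by (auto simp: order_tendsto_iff)
  then obtain b where b: "p < G b"
    by (meson eventually_at_top_linorder order_refl)
  have "a \<le> b"
    using a b by (meson G_le_iff less_imp_le order_trans)
  then show ?thesis
    using IVT[of G a p b] a b isCont_G by auto
qed

text \<open>
  The regions of the tests compare a statistic with \<open>G_inv\<close>. This case distinction moves the
  comparison to the scale of probabilities, where the two infinite quantiles need no special treatment.
\<close>

lemma G_inv_cases:
  assumes "p \<in> {0..1}"
  obtains (zero) "p = 0" "G_inv p = -\<infinity>"
    | (one) "p = 1" "G_inv p = \<infinity>"
    | (inner) z where "p = G z" "G_inv p = ereal z"
proof -
  consider "p = 0" | "p = 1" | "0 < p" "p < 1"
    using assms by fastforce
  then show thesis
  proof cases
    case 3
    then obtain z where z: "p = G z"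
      using G_surj by metis
    moreover have "the_inv G (G z) = z"
      using G_strict_mono by (intro the_inv_f_f strict_mono_imp_inj_on)
    ultimately show thesis
      using inner 3 by (simp add: G_inv_def)
  qed (use zero one in \<open>simp_all add: G_inv_def\<close>)
qed

lemma G_inv_le_iff: "p \<in> {0..1} \<Longrightarrow> G_inv p \<le> ereal x \<longleftrightarrow> p \<le> G x"
  by (cases p rule: G_inv_cases) (auto simp: less_imp_le not_le)

lemma G_inv_less_iff: "p \<in> {0..1} \<Longrightarrow> G_inv p < ereal x \<longleftrightarrow> p < G x"
  by (cases p rule: G_inv_cases) (auto simp: less_imp_le not_less)

lemma le_G_inv_iff: "p \<in> {0..1} \<Longrightarrow> ereal x \<le> G_inv p \<longleftrightarrow> G x \<le> p"
  using G_inv_less_iff[of p x] by (simp add: not_less[symmetric])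

section \<open>The numerical value of the quantile\<close>

text \<open>
  The value of the quantile comes from integrating the Taylor polynomials of the exponential, so
  the density is used here without its normalising constant.
\<close>

lemma exp_has_integral_G:
  assumes "0 \<le> b"
  shows "((\<lambda>t. exp (- t\<^sup>2 / 2)) has_integral sqrt (2 * pi) * (G b - 1 / 2)) {0..b}"
proof -
  have "integrable lborel (std_normal_density)"
    by (rule integrable_normal_density) simp
  then have i: "set_integrable lborel {0..b} std_normal_density"
    unfolding set_integrable_def by (intro integrable_mult_indicator) auto
  have "G b = measure (normal1 0) {..<0} + measure (normal1 0) {0..b}"
    unfolding G_eq using assms
    by (subst normal1.finite_measure_Union[symmetric])
       (auto intro!: arg_cong[where f = "measure (normal1 0)"])
  then have "G b - 1 / 2 = measure (normal1 0) {0..b}"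
    by (simp add: measure_normal1_lessThan G_0)
  also have "\<dots> = (\<integral>x. indicator {0..b} x \<partial>normal1 0)"
    by simp
  also have "\<dots> = (LINT x:{0..b}|lborel. std_normal_density x)"
    unfolding normal1_def set_lebesgue_integral_def
    by (subst integral_density) (auto intro!: Bochner_Integration.integral_cong)
  finally have "G b - 1 / 2 = (LINT x:{0..b}|lborel. std_normal_density x)" .
  then have "(std_normal_density has_integral (G b - 1 / 2)) {0..b}"
    using set_borel_integral_eq_integral[OF i] by (simp add: has_integral_integrable_integral)
  from has_integral_mult_right[OF this, of "sqrt (2 * pi)"]
  show ?thesis
    by (simp add: std_normal_density_def)
qed

lemma has_integral_exp_taylor:
  fixes b :: real
  assumes "0 \<le> b"
  shows "((\<lambda>t. \<Sum>m<n. (- t\<^sup>2 / 2) ^ m / fact m) has_integral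
     (\<Sum>m<n. (- 1 / 2) ^ m * b ^ (2 * m + 1) / (fact m * real (2 * m + 1)))) {0..b}"
proof -
  have D: "((\<lambda>t. (- 1 / 2) ^ m * t ^ (2 * m + 1) / (fact m * real (2 * m + 1)))
      has_real_derivative (- t\<^sup>2 / 2) ^ m / fact m) (at t within {0..b})" for m and t :: real
  proof -
    have "(- t\<^sup>2 / 2) ^ m = (- 1 / 2) ^ m * t ^ (2 * m)"
      by (simp add: power_mult power_mult_distrib[symmetric])
    then have "(- 1 / 2) ^ m * (real (2 * m + 1) * t ^ (2 * m)) / (fact m * real (2 * m + 1))
        = (- t\<^sup>2 / 2) ^ m / fact m"
      by simp
    moreover have "((\<lambda>t. (- 1 / 2) ^ m * t ^ (2 * m + 1) / (fact m * real (2 * m + 1)))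
      has_real_derivative (- 1 / 2) ^ m * (real (2 * m + 1) * t ^ (2 * m)) / (fact m * real (2 * m + 1)))
      (at t within {0..b})"
      using DERIV_pow[of "2 * m + 1" t "{0..b}"] by (intro DERIV_cdivide DERIV_cmult) simp
    ultimately show ?thesis
      by simp
  qed
  have "((\<lambda>t. \<Sum>m<n. (- t\<^sup>2 / 2) ^ m / fact m) has_integral
     (\<Sum>m<n. (- 1 / 2) ^ m * b ^ (2 * m + 1) / (fact m * real (2 * m + 1)))
     - (\<Sum>m<n. (- 1 / 2) ^ m * 0 ^ (2 * m + 1) / (fact m * real (2 * m + 1)))) {0..b}"
    using assms D
    by (intro fundamental_theorem_of_calculus)
       (auto simp only: has_real_derivative_iff_has_vector_derivative[symmetric] intro!: DERIV_sum)
  then show ?thesis by simp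
qed

text \<open>
  The Lagrange remainder has the sign of \<open>(- u) ^ n\<close>, so the partial sums enclose the exponential
  from alternating sides, for every \<open>u \<ge> 0\<close>.
\<close>

lemma exp_minus_taylor_bounds:
  fixes u :: real
  assumes "0 \<le> u"
  shows "even n \<Longrightarrow> (\<Sum>m<n. (- u) ^ m / fact m) \<le> exp (- u)"
    and "odd n \<Longrightarrow> exp (- u) \<le> (\<Sum>m<n. (- u) ^ m / fact m)"
proof -
  obtain t where t: "exp (- u) = (\<Sum>m<n. (- u) ^ m / fact m) + (exp t / fact n) * (- u) ^ n"
    using Maclaurin_exp_le by blast
  show "(\<Sum>m<n. (- u) ^ m / fact m) \<le> exp (- u)" if "even n"
    using that t by (simp add: zero_le_even_power)
  show "exp (- u) \<le> (\<Sum>m<n. (- u) ^ m / fact m)" if "odd n"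
    using that t assms by (simp add: mult_nonneg_nonpos)
qed

lemma G_series_bounds:
  fixes b :: real and n :: nat
  assumes "0 \<le> b"
  defines "S \<equiv> \<Sum>m<n. (- 1 / 2) ^ m * b ^ (2 * m + 1) / (fact m * real (2 * m + 1))"
  shows "even n \<Longrightarrow> S \<le> sqrt (2 * pi) * (G b - 1 / 2)"
    and "odd n \<Longrightarrow> sqrt (2 * pi) * (G b - 1 / 2) \<le> S"
proof -
  note I = exp_has_integral_G[OF assms(1)] has_integral_exp_taylor[OF assms(1), of n, folded S_def]
  have E: "even n \<Longrightarrow> (\<Sum>m<n. (- t\<^sup>2 / 2) ^ m / fact m) \<le> exp (- t\<^sup>2 / 2)"
          "odd n \<Longrightarrow> exp (- t\<^sup>2 / 2) \<le> (\<Sum>m<n. (- t\<^sup>2 / 2) ^ m / fact m)" for t :: real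
    using exp_minus_taylor_bounds[of "t\<^sup>2 / 2" n] by simp_all
  show "even n \<Longrightarrow> S \<le> sqrt (2 * pi) * (G b - 1 / 2)"
    using has_integral_le[OF I(2) I(1)] E by blast
  show "odd n \<Longrightarrow> sqrt (2 * pi) * (G b - 1 / 2) \<le> S"
    using has_integral_le[OF I(1) I(2)] E by blast
qed

text \<open>
  At \<open>1.955\<close> and \<open>1.965\<close> the function \<open>G\<close> differs from \<open>0.975\<close> by about \<open>3 * 10 ^ - 4\<close>. Eleven,
  respectively ten, terms of the series have an error below \<open>10 ^ - 4\<close> there, and two parity-matched
  partial sums therefore separate the quantile from both points.
\<close>

lemma quantile_bounds:
  assumes "G b = 0.975"
  shows "\<bar>b - 1.96\<bar> < 0.005"
proof -
  have sqrt_lower: "2.5066 < sqrt (2 * pi)"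
    by (rule real_less_rsqrt) (use pi_approx in \<open>simp add: power2_eq_square\<close>)
  have sqrt_upper: "sqrt (2 * pi) < 2.5067"
    by (rule real_less_lsqrt) (use pi_approx in \<open>simp_all add: power2_eq_square\<close>)
  have "sqrt (2 * pi) * (G 1.955 - 1 / 2) \<le> 1.19"
    by (rule order_trans[OF G_series_bounds(2)[of _ 11]])
       (simp_all add: lessThan_nat_numeral lessThan_Suc fact_numeral power_divide)
  also have "\<dots> < 2.5066 * 0.475" by simp
  also have "\<dots> < sqrt (2 * pi) * 0.475" using sqrt_lower by simp
  finally have "G 1.955 - 1 / 2 < 0.475"
    using sqrt_lower by (simp add: mult_less_cancel_left)
  then have lower: "G 1.955 < G b"
    using assms by (simp del: G_less_iff)
  have "sqrt (2 * pi) * 0.475 < 2.5067 * 0.475" using sqrt_upper by simp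
  also have "\<dots> < 1.1911" by simp
  also have "\<dots> \<le> sqrt (2 * pi) * (G 1.965 - 1 / 2)"
    by (rule order_trans[OF _ G_series_bounds(1)[of _ 10]])
       (simp_all add: lessThan_nat_numeral lessThan_Suc fact_numeral power_divide)
  finally have "0.475 < G 1.965 - 1 / 2"
    using sqrt_lower by (simp add: mult_less_cancel_left)
  then have upper: "G b < G 1.965"
    using assms by (simp del: G_less_iff)
  show ?thesis
    using lower upper unfolding abs_less_iff by simp
qed

section \<open>Normal data in one and two dimensions\<close>

lemma G_measurable [measurable]: "G \<in> borel_measurable borel"
  by (intro borel_measurable_continuous_onI continuous_at_imp_continuous_on ballI isCont_G)

text \<open>
  The probability integral transform: under mean \<open>h\<close>, \<open>G (x - h)\<close> is uniformly distributed on the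
  unit interval.
\<close>

lemma measure_normal1_G:
  assumes p: "p \<in> {0..1}"
  shows "measure (normal1 h) {x. G (x - h) < p} = p"
    and "measure (normal1 h) {x. G (x - h) \<le> p} = p"
    and "measure (normal1 h) {x. p \<le> G (x - h)} = 1 - p"
    and "measure (normal1 h) {x. p < G (x - h)} = 1 - p"
proof -
  show less: "measure (normal1 h) {x. G (x - h) < p} = p"
    using p
  proof (cases p rule: G_inv_cases)
    case (inner z)
    then have "{x. G (x - h) < p} = {..<z + h}" by auto
    then show ?thesis using inner by (simp add: measure_normal1_lessThan)
  qed (use normal1.prob_space[of h] in \<open>auto simp: less_le_not_le[of _ "0::real"] less_imp_le\<close>)
  show le: "measure (normal1 h) {x. G (x - h) \<le> p} = p"
    using p
  proof (cases p rule: G_inv_cases)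
    case (inner z)
    then have "{x. G (x - h) \<le> p} = {..z + h}" by auto
    then show ?thesis using inner by (simp add: measure_normal1_atMost)
  qed (use normal1.prob_space[of h] in \<open>auto simp: less_imp_le not_le[THEN iffD2]\<close>)
  have "{x. p \<le> G (x - h)} = UNIV - {x. G (x - h) < p}" by auto
  then show "measure (normal1 h) {x. p \<le> G (x - h)} = 1 - p"
    using normal1.prob_compl[of "{x. G (x - h) < p}" h] less by simp
  have "{x. p < G (x - h)} = UNIV - {x. G (x - h) \<le> p}" by auto
  then show "measure (normal1 h) {x. p < G (x - h)} = 1 - p"
    using normal1.prob_compl[of "{x. G (x - h) \<le> p}" h] le by simp
qed

lemma sets_normal2 [simp, measurable_cong]: "sets (normal2 h) = sets (borel \<Otimes>\<^sub>M borel)"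
  unfolding normal2_def by (intro sets_pair_measure_cong) simp_all

lemma space_normal2 [simp]: "space (normal2 h) = UNIV"
  by (simp add: normal2_def space_pair_measure)

lemma prob_space_normal2: "prob_space (normal2 h)"
  unfolding normal2_def by (intro prob_space_pair prob_space_normal1)

interpretation normal2: prob_space "normal2 h" for h
  by (rule prob_space_normal2)

lemma measure_normal2_Times:
  assumes "A \<in> sets borel" "B \<in> sets borel"
  shows "measure (normal2 h) (A \<times> B) = measure (normal1 (fst h)) A * measure (normal1 (snd h)) B"
  using assms unfolding normal2_def
  by (simp add: measure_def normal1.emeasure_pair_measure_Times enn2real_mult)

lemma measure_normal2_marginal:
  assumes "\<pi> \<in> {fst, snd}" "{x. Q x} \<in> sets borel"
  shows "measure (normal2 h) {x. Q (\<pi> x)} = measure (normal1 (\<pi> h)) {x. Q x}"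
proof -
  have UNIV: "measure (normal1 m) UNIV = 1" for m
    using normal1.prob_space[of m] by simp
  have eq: "{x. Q (fst x)} = {x. Q x} \<times> UNIV" "{x. Q (snd x)} = UNIV \<times> {x. Q x}"
    by auto
  have "measure (normal2 h) {x. Q (fst x)} = measure (normal1 (fst h)) {x. Q x}"
    "measure (normal2 h) {x. Q (snd x)} = measure (normal1 (snd h)) {x. Q x}"
    unfolding eq using assms(2) by (simp_all add: measure_normal2_Times UNIV)
  then show ?thesis
    using assms(1) by auto
qed

text \<open>
  The likelihood ratio of mean \<open>a\<close> against mean \<open>b\<close>. It is monotone in the observation, with
  direction given by the sign of \<open>a - b\<close>; this is what makes half-lines optimal.
\<close>

definition normal_ratio :: "real \<Rightarrow> real \<Rightarrow> real \<Rightarrow> real" where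
  "normal_ratio a b x = exp ((a - b) * x - (a\<^sup>2 - b\<^sup>2) / 2)"

lemma normal_ratio_simps [simp]: "0 \<le> normal_ratio a b x" "normal_ratio a a x = 1"
  by (simp_all add: normal_ratio_def)

lemma normal_ratio_mono: "b \<le> a \<Longrightarrow> x \<le> y \<Longrightarrow> normal_ratio a b x \<le> normal_ratio a b y"
  by (simp add: normal_ratio_def mult_left_mono)

lemma normal_ratio_antimono: "a \<le> b \<Longrightarrow> x \<le> y \<Longrightarrow> normal_ratio a b y \<le> normal_ratio a b x"
  by (simp add: normal_ratio_def mult_left_mono_neg)

lemma normal_ratio_measurable [measurable]: "normal_ratio a b \<in> borel_measurable borel"
  unfolding normal_ratio_def by measurable

lemma normal1_eq_density: "normal1 a = density (normal1 b) (normal_ratio a b)"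
proof -
  have "normal_density a 1 x = normal_density b 1 x * normal_ratio a b x" for x
    by (simp add: normal_density_def normal_ratio_def exp_add[symmetric] power2_eq_square field_simps)
  then show ?thesis
    unfolding normal1_def
    by (subst density_density_eq) (auto simp: ennreal_mult)
qed

lemma normal2_eq_density:
  "normal2 h = density (normal2 k)
     (\<lambda>x. normal_ratio (fst h) (fst k) (fst x) * normal_ratio (snd h) (snd k) (snd x))"
proof -
  have "normal2 h = density (normal1 (fst k)) (normal_ratio (fst h) (fst k))
      \<Otimes>\<^sub>M density (normal1 (snd k)) (normal_ratio (snd h) (snd k))"
    by (simp add: normal2_def normal1_eq_density[symmetric])
  also have "\<dots> = density (normal2 k)
     (\<lambda>(x, y). ennreal (normal_ratio (fst h) (fst k) x) * ennreal (normal_ratio (snd h) (snd k) y))"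
    unfolding normal2_def
    by (intro pair_measure_density)
       (auto simp: normal1_eq_density[symmetric] normal1.sigma_finite_measure_axioms)
  finally show ?thesis
    by (simp add: case_prod_beta' ennreal_mult)
qed

section \<open>Optimal regions\<close>

text \<open>
  The Neyman-Pearson lemma for the likelihood ratio \<open>r\<close>, without a prescribed critical value: the
  threshold \<open>k\<close> is recovered as the supremum of \<open>r\<close> off \<open>C\<close>. In this form it also covers the empty region, off which the ratio may be
  unbounded, so that no finite critical value exists.

  With the common part removed, the competitor keeps \<open>D\<close> and the region keeps \<open>E\<close>. Passing to the
  alternative multiplies the probability of \<open>D\<close> by at most \<open>k\<close> and that of \<open>E\<close> by at least \<open>k\<close>.
\<close>

lemma neyman_pearson:
  fixes r :: "'x \<Rightarrow> real"
  assumes "prob_space P" "prob_space (density P r)"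
    and [measurable]: "r \<in> borel_measurable P" "C \<in> sets P" "C' \<in> sets P"
    and mono: "\<And>x y. x \<in> C \<Longrightarrow> y \<in> space P - C \<Longrightarrow> r y \<le> r x"
    and le: "measure P C' \<le> measure P C"
  shows "measure (density P r) C' \<le> measure (density P r) C"
proof -
  interpret P: prob_space P by fact
  interpret Q: prob_space "density P r" by fact
  define D E where "D = C' - C" and "E = C - C'"
  have [measurable]: "D \<in> sets P" "E \<in> sets P"
    by (simp_all add: D_def E_def)
  have split: "measure M C' = measure M (C \<inter> C') + measure M D"
      "measure M C = measure M (C \<inter> C') + measure M E"
    if "prob_space M" "sets M = sets P" for M
  proof -
    interpret M: prob_space M by fact
    have "C' = (C \<inter> C') \<union> D" "C = (C \<inter> C') \<union> E" by (auto simp: D_def E_def)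
    moreover have "(C \<inter> C') \<inter> D = {}" "(C \<inter> C') \<inter> E = {}" by (auto simp: D_def E_def)
    ultimately show "measure M C' = measure M (C \<inter> C') + measure M D"
        "measure M C = measure M (C \<inter> C') + measure M E"
      using that(2) by (metis M.finite_measure_Union \<open>D \<in> sets P\<close> \<open>E \<in> sets P\<close> assms(4,5) sets.Int)+
  qed
  have PDE: "measure P D \<le> measure P E"
    using split[of P] le P.prob_space_axioms by simp
  have "measure (density P r) D \<le> measure (density P r) E"
  proof (cases "D = {} \<or> E = {}")
    case True
    then have "emeasure P D = 0"
      using PDE by (auto simp: P.emeasure_eq_measure measure_le_0_iff)
    then have "AE x in P. x \<notin> D"
      by (intro AE_not_in) (simp add: null_sets_def)
    then have "D \<in> null_sets (density P r)"
      by (subst null_sets_density_iff) auto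
    then have "measure (density P r) D = 0"
      by (simp add: measure_def null_sets_def)
    then show ?thesis by simp
  next
    case False
    then obtain x y where xy: "x \<in> E" "y \<in> D" by blast
    define k where "k = Sup (r ` (space P - C))"
    have D_sub: "D \<subseteq> space P - C"
      using sets.sets_into_space[of C' P] by (auto simp: D_def)
    have "bdd_above (r ` (space P - C))"
      using mono xy(1) by (intro bdd_aboveI2[of _ _ "r x"]) (auto simp: E_def)
    then have k_D: "r z \<le> k" if "z \<in> D" for z
      unfolding k_def using that D_sub by (intro cSup_upper) auto
    have k_E: "k \<le> r z" if "z \<in> E" for z
      unfolding k_def using that xy(2) D_sub mono by (intro cSup_least) (auto simp: E_def)
    have "emeasure (density P r) D = (\<integral>\<^sup>+ z. ennreal (r z) * indicator D z \<partial>P)"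
      by (simp add: emeasure_density)
    also have "\<dots> \<le> (\<integral>\<^sup>+ z. ennreal k * indicator D z \<partial>P)"
      using k_D by (intro nn_integral_mono) (auto simp: indicator_def intro!: ennreal_leI)
    also have "\<dots> = ennreal k * emeasure P D"
      by (simp add: nn_integral_cmult_indicator)
    also have "\<dots> \<le> ennreal k * emeasure P E"
      using PDE by (intro mult_left_mono) (simp_all add: P.emeasure_eq_measure ennreal_leI)
    also have "\<dots> = (\<integral>\<^sup>+ z. ennreal k * indicator E z \<partial>P)"
      by (simp add: nn_integral_cmult_indicator)
    also have "\<dots> \<le> (\<integral>\<^sup>+ z. ennreal (r z) * indicator E z \<partial>P)"
      using k_E by (intro nn_integral_mono) (auto simp: indicator_def intro!: ennreal_leI)
    also have "\<dots> = emeasure (density P r) E"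
      by (simp add: emeasure_density)
    finally show ?thesis
      by (simp add: Q.emeasure_eq_measure)
  qed
  then show ?thesis
    using split[of "density P r"] Q.prob_space_axioms by simp
qed

text \<open>
  For a composite null hypothesis it is enough to find, for each alternative, one member \<open>k\<close> of the
  null hypothesis that is least favourable to it and at which \<open>C\<close> has the full size \<open>1 - \<eta>\<close>: the
  bound on the size of a competitor at \<open>k\<close> already limits its power.
\<close>

lemma uniformly_optimal_neyman_pearson:
  fixes C :: "'x set"
  assumes crit: "critical_region \<Theta> P H0 \<eta> C"
    and prob: "\<And>h. h \<in> \<Theta> \<Longrightarrow> prob_space (P h)" and "H0 \<subseteq> \<Theta>"
    and ratio: "\<And>h. h \<in> \<Theta> - H0 \<Longrightarrow> \<exists>k\<in>H0. \<exists>r :: 'x \<Rightarrow> real. r \<in> borel_measurable (P k) \<and>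
      P h = density (P k) (\<lambda>x. ennreal (r x)) \<and> (\<forall>x\<in>C. \<forall>y\<in>space (P k) - C. r y \<le> r x) \<and> measure (P k) C = 1 - \<eta>"
  shows "uniformly_optimal \<Theta> P H0 \<eta> C"
  unfolding uniformly_optimal_within_def
proof (intro conjI ballI impI)
  fix C' h
  assume C': "critical_region \<Theta> P H0 \<eta> C'" and h: "h \<in> \<Theta> - H0"
  obtain k and r :: "'x \<Rightarrow> real" where k: "k \<in> H0" and r: "r \<in> borel_measurable (P k)"
    "P h = density (P k) r" "\<forall>x\<in>C. \<forall>y\<in>space (P k) - C. r y \<le> r x" "measure (P k) C = 1 - \<eta>"
    using ratio[OF h] by blast
  have "measure (density (P k) r) C' \<le> measure (density (P k) r) C"
    using prob prob[of h, unfolded r(2)] k r crit C' h \<open>H0 \<subseteq> \<Theta>\<close>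
    by (intro neyman_pearson) (auto simp: critical_region_def)
  then show "measure (P h) C' \<le> measure (P h) C"
    by (simp add: r)
qed (use crit in auto)

section \<open>Confidence and level of a test\<close>

text \<open>
  The supremum is insensitive to the boundary, so regions given by weak and by strict inequalities
  lead to the same confidence.
\<close>

lemma frequentist_confidence_eqI:
  assumes "0 \<le> v" "v \<le> 1"
    and "\<And>\<eta>. \<eta> \<in> {0..1} \<Longrightarrow> \<eta> < v \<Longrightarrow> x \<in> C \<eta>"
    and "\<And>\<eta>. \<eta> \<in> {0..1} \<Longrightarrow> x \<in> C \<eta> \<Longrightarrow> \<eta> \<le> v"
  shows "frequentist_confidence C x = v"
  unfolding frequentist_confidence_def
proof (rule antisym)
  let ?A = "{\<eta> \<in> {0..1}. x \<in> C \<eta>} \<union> {0}"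
  show "Sup ?A \<le> v"
    using assms by (intro cSup_least) auto
  have bdd: "bdd_above ?A"
    by (intro bdd_aboveI[of _ 1]) auto
  show "v \<le> Sup ?A"
  proof (rule dense_le)
    fix y assume "y < v"
    then have "max y 0 \<in> ?A"
      using assms by (auto simp: max_def)
    then have "max y 0 \<le> Sup ?A"
      using bdd by (rule cSup_upper)
    then show "y \<le> Sup ?A" by simp
  qed
qed

lemma valid_nested_familyI:
  assumes "\<And>\<eta> h. \<eta> \<in> {0..1} \<Longrightarrow> h \<in> \<Theta> \<Longrightarrow> C \<eta> \<in> sets (P h)"
    and "\<And>\<eta> h. \<eta> \<in> {0..1} \<Longrightarrow> h \<in> H0 \<Longrightarrow> measure (P h) (C \<eta>) \<le> 1 - \<eta>"
    and "\<And>\<eta> \<eta>' x. \<eta> \<in> {0..1} \<Longrightarrow> \<eta>' \<in> {0..1} \<Longrightarrow> \<eta> \<le> \<eta>' \<Longrightarrow> x \<in> C \<eta>' \<Longrightarrow> x \<in> C \<eta>"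
  shows "valid_nested_family \<Theta> P H0 C"
  using assms unfolding valid_nested_family_def critical_region_def by blast

lemma confidence_level_attained:
  assumes "k \<in> H0" "\<And>h. h \<in> H0 \<Longrightarrow> measure (P h) C \<le> measure (P k) C"
  shows "confidence_level P H0 C = 1 - measure (P k) C"
proof -
  have "(SUP h\<in>H0. measure (P h) C) = measure (P k) C"
    using assms by (intro cSup_eq_maximum) auto
  then show ?thesis by (simp add: confidence_level_def)
qed

lemma bdd_above_measure:
  assumes "\<And>h. h \<in> H0 \<Longrightarrow> prob_space (P h)"
  shows "bdd_above ((\<lambda>h. measure (P h) C) ` H0)"
  using assms by (intro bdd_aboveI2[of _ _ 1]) (simp add: prob_space.prob_le_1)

lemma valid_single_region_family:
  assumes prob: "\<And>h. h \<in> \<Theta> \<Longrightarrow> prob_space (P h) \<and> space (P h) = UNIV"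
    and C: "\<And>h. h \<in> \<Theta> \<Longrightarrow> C \<in> sets (P h)" and "H0 \<subseteq> \<Theta>"
  shows "valid_nested_family \<Theta> P H0 (single_region_family P H0 C)"
proof (rule valid_nested_familyI)
  fix \<eta> :: real and h assume "\<eta> \<in> {0..1}" "h \<in> \<Theta>"
  then show "single_region_family P H0 C \<eta> \<in> sets (P h)"
    using prob[of h] C[of h] sets.top[of "P h"] by (simp add: single_region_family_def)
next
  fix \<eta> :: real and h assume \<eta>: "\<eta> \<in> {0..1}" and h: "h \<in> H0"
  then interpret prob_space "P h"
    using prob \<open>H0 \<subseteq> \<Theta>\<close> by blast
  have "measure (P h) C \<le> (SUP h\<in>H0. measure (P h) C)"
    using h prob \<open>H0 \<subseteq> \<Theta>\<close> by (intro cSUP_upper bdd_above_measure) auto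
  then show "measure (P h) (single_region_family P H0 C \<eta>) \<le> 1 - \<eta>"
    using \<eta> by (auto simp: single_region_family_def confidence_level_def)
qed (auto simp: single_region_family_def split: if_splits)

lemma frequentist_confidence_single_region:
  assumes "x \<in> C" "0 \<le> confidence_level P H0 C" "confidence_level P H0 C \<le> 1"
  shows "frequentist_confidence (single_region_family P H0 C) x = confidence_level P H0 C"
  using assms
  by (intro frequentist_confidence_eqI) (auto simp: single_region_family_def split: if_splits)

section \<open>Probabilities under null hypotheses\<close>

text \<open>
  Lowering the mean shifts the data down, so among the means \<open>h \<le> 0\<close> the extreme case is \<open>h = 0\<close>,
  where \<open>measure_normal1_G\<close> gives equality.
\<close>

lemma measure_normal1_G_null:
  assumes p: "p \<in> {0..1}" and h: "h \<le> 0"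
  shows "p \<le> measure (normal1 h) {x. G x \<le> p}"
    and "measure (normal1 h) {x. p \<le> G x} \<le> 1 - p"
    and "measure (normal1 h) {x. p < G x} \<le> 1 - p"
proof -
  have le: "G x \<le> G (x - h)" for x
    using h by simp
  have "measure (normal1 h) {x. G (x - h) \<le> p} \<le> measure (normal1 h) {x. G x \<le> p}"
    using le by (intro normal1.finite_measure_mono) (auto intro: order_trans simp del: G_le_iff)
  then show "p \<le> measure (normal1 h) {x. G x \<le> p}"
    using p by (simp add: measure_normal1_G)
  have "measure (normal1 h) {x. p \<le> G x} \<le> measure (normal1 h) {x. p \<le> G (x - h)}"
    using le by (intro normal1.finite_measure_mono) (auto intro: order_trans simp del: G_le_iff)
  then show "measure (normal1 h) {x. p \<le> G x} \<le> 1 - p"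
    using p by (simp add: measure_normal1_G)
  have "measure (normal1 h) {x. p < G x} \<le> measure (normal1 h) {x. p < G (x - h)}"
    using le by (intro normal1.finite_measure_mono) (auto intro: less_le_trans simp del: G_le_iff)
  then show "measure (normal1 h) {x. p < G x} \<le> 1 - p"
    using p by (simp add: measure_normal1_G)
qed

lemma measure_normal2_either:
  assumes "{x. Q x} \<in> sets borel" "{x. R x} \<in> sets borel"
  shows "measure (normal2 h) {x. Q (fst x) \<or> R (snd x)} =
    1 - measure (normal1 (fst h)) {x. \<not> Q x} * measure (normal1 (snd h)) {x. \<not> R x}"
proof -
  have [measurable]: "{x. \<not> Q x} \<in> sets borel" "{x. \<not> R x} \<in> sets borel"
    using assms by (auto simp: Collect_neg_eq)
  have "{x. Q (fst x) \<or> R (snd x)} = UNIV - {x. \<not> Q x} \<times> {x. \<not> R x}"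
    by auto
  then show ?thesis
    using normal2.prob_compl[of "{x. \<not> Q x} \<times> {x. \<not> R x}" h]
    by (simp add: measure_normal2_Times)
qed

lemma measure_normal2_quadrant:
  "measure (normal2 h) {x. a \<le> fst x \<and> b \<le> snd x} = (1 - G (a - fst h)) * (1 - G (b - snd h))"
proof -
  have tail: "measure (normal1 m) {c..} = 1 - G (c - m)" for c m
    using normal1.prob_compl[of "{..<c}" m]
    by (simp add: measure_normal1_lessThan Compl_eq_Diff_UNIV[symmetric])
  have "{x. a \<le> fst x \<and> b \<le> snd x} = {a..} \<times> {b..}"
    by auto
  then show ?thesis
    by (simp add: measure_normal2_Times tail)
qed

section \<open>Two simple hypotheses\<close>

lemma G_inv_minus_le_iff:
  "\<eta> \<in> {0..1} \<Longrightarrow> G_inv \<eta> - ereal b \<le> ereal x \<longleftrightarrow> \<eta> \<le> G (b + x)"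
  by (cases \<eta> rule: G_inv_cases) (auto simp: less_imp_le not_le)

lemma le_G_inv_plus_iff:
  assumes "\<eta> \<in> {0..1}"
  shows "ereal x \<le> G_inv (1 - \<eta>) + ereal b \<longleftrightarrow> \<eta> \<le> G (b - x)"
proof -
  have "1 - \<eta> \<in> {0..1}" using assms by auto
  then show ?thesis
  proof (cases "1 - \<eta>" rule: G_inv_cases)
    case (inner z)
    then have "\<eta> = G (- z)" by (simp add: G_minus)
    then show ?thesis using inner by auto
  qed (auto simp: less_imp_le not_le)
qed

text \<open>
  Both tests of one point against the other at once: \<open>s\<close> is the sign of the alternative mean. The
  two are mirror images, and at the midpoint \<open>x = 0\<close> they give the same confidence.
\<close>

lemma two_point_test:
  assumes "0 < b" and s: "s = 1 \<or> s = -1"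
    and C: "\<And>\<eta>. \<eta> \<in> {0..1} \<Longrightarrow> C \<eta> = {x. \<eta> \<le> G (b + s * x)}"
  shows "valid_nested_family {- b, b} normal1 {- s * b} C"
    and "uniformly_optimal_family {- b, b} normal1 {- s * b} C"
    and "frequentist_confidence C 0 = G b"
proof -
  have size: "measure (normal1 (- s * b)) (C \<eta>) = 1 - \<eta>" if \<eta>: "\<eta> \<in> {0..1}" for \<eta>
  proof (cases "s = 1")
    case True
    then show ?thesis
      using measure_normal1_G(3)[OF \<eta>, of "- b"] by (simp add: C[OF \<eta>] add.commute)
  next
    case False
    then have "s = -1" using s by blast
    moreover have "\<eta> \<le> G (b - x) \<longleftrightarrow> G (x - b) \<le> 1 - \<eta>" for x
      using G_minus[of "x - b"] by auto
    moreover have "1 - \<eta> \<in> {0..1}" using \<eta> by auto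
    ultimately show ?thesis
      using measure_normal1_G(2)[of "1 - \<eta>" b] by (simp add: C[OF \<eta>])
  qed
  have sets: "C \<eta> \<in> sets (normal1 h)" if \<eta>: "\<eta> \<in> {0..1}" for \<eta> h
    by (simp add: C[OF \<eta>])
  show "valid_nested_family {- b, b} normal1 {- s * b} C"
    using size sets by (intro valid_nested_familyI) (auto simp: C)
  show "uniformly_optimal_family {- b, b} normal1 {- s * b} C"
    unfolding uniformly_optimal_family_def
  proof
    fix \<eta> :: real assume \<eta>: "\<eta> \<in> {0..1}"
    let ?r = "normal_ratio (s * b) (- s * b)"
    have mono: "?r y \<le> ?r x" if "x \<in> C \<eta>" "y \<notin> C \<eta>" for x y
    proof -
      have "G (b + s * y) < G (b + s * x)"
        using that \<eta> by (auto simp: C simp del: G_less_iff)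
      then show ?thesis
        using s \<open>0 < b\<close>
        by (elim disjE) (simp_all add: normal_ratio_mono normal_ratio_antimono)
    qed
    show "uniformly_optimal {- b, b} normal1 {- s * b} \<eta> (C \<eta>)"
    proof (rule uniformly_optimal_neyman_pearson)
      show "critical_region {- b, b} normal1 {- s * b} \<eta> (C \<eta>)"
        using sets size \<eta> by (simp add: critical_region_def)
    next
      fix h assume "h \<in> {- b, b} - {- s * b}"
      then have h: "h = s * b" using s by auto
      show "\<exists>k\<in>{- s * b}. \<exists>r. r \<in> borel_measurable (normal1 k) \<and>
          normal1 h = density (normal1 k) (\<lambda>x. ennreal (r x)) \<and>
          (\<forall>x\<in>C \<eta>. \<forall>y\<in>space (normal1 k) - C \<eta>. r y \<le> r x) \<and>
          measure (normal1 k) (C \<eta>) = 1 - \<eta>"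
        using mono size[OF \<eta>] normal1_eq_density[of "s * b" "- s * b"]
        by (intro bexI[of _ "- s * b"] exI[of _ ?r]) (auto simp: h)
    qed (use s prob_space_normal1 in auto)
  qed
  show "frequentist_confidence C 0 = G b"
    by (rule frequentist_confidence_eqI) (auto simp: C less_imp_le)
qed

section \<open>One-sided and two-sided tests\<close>

lemma one_sided_test:
  assumes C: "\<And>\<eta>. \<eta> \<in> {0..1} \<Longrightarrow> C \<eta> = {x. \<eta> \<le> G x}"
  shows "valid_nested_family UNIV normal1 {h. h \<le> 0} C"
    and "frequentist_confidence C x = G x"
proof -
  show "valid_nested_family UNIV normal1 {h. h \<le> 0} C"
    by (intro valid_nested_familyI) (auto simp: C measure_normal1_G_null)
  show "frequentist_confidence C x = G x"
    by (rule frequentist_confidence_eqI) (auto simp: C less_imp_le)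
qed

text \<open>
  The two-sided region spends half of its size on each tail, so the confidence \<open>1 - 2 * (1 - G x)\<close>
  of an observation \<open>x \<ge> 0\<close> is twice as far from \<open>1\<close> as that of the one-sided test.
\<close>

lemma two_sided_test:
  assumes C: "\<And>\<eta>. \<eta> \<in> {0..1} \<Longrightarrow> C \<eta> = {x. G x \<le> (1 - \<eta>) / 2} \<union> {x. 1 - (1 - \<eta>) / 2 \<le> G x}"
  shows "valid_nested_family UNIV normal1 {0} C"
    and "frequentist_confidence C x = \<bar>2 * G x - 1\<bar>"
proof -
  show "valid_nested_family UNIV normal1 {0} C"
  proof (rule valid_nested_familyI)
    fix \<eta> h :: real assume \<eta>: "\<eta> \<in> {0..1}" and "h \<in> {0}"
    then have "(1 - \<eta>) / 2 \<in> {0..1}" "1 - (1 - \<eta>) / 2 \<in> {0..1}" "h = 0" by auto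
    then show "measure (normal1 h) (C \<eta>) \<le> 1 - \<eta>"
      using measure_normal1_G(2)[of "(1 - \<eta>) / 2" 0] measure_normal1_G(3)[of "1 - (1 - \<eta>) / 2" 0]
        measure_Un_le[of "{x. G x \<le> (1 - \<eta>) / 2}" "normal1 0" "{x. 1 - (1 - \<eta>) / 2 \<le> G x}"]
      by (simp add: C[OF \<eta>])
  qed (auto simp: C field_simps)
  have "x \<in> C \<eta> \<longleftrightarrow> \<eta> \<le> \<bar>2 * G x - 1\<bar>" if "\<eta> \<in> {0..1}" for \<eta>
    using that by (auto simp: C field_simps)
  then show "frequentist_confidence C x = \<bar>2 * G x - 1\<bar>"
    using G_pos[of x] G_less_1[of x]
    by (intro frequentist_confidence_eqI) (auto simp del: G_pos G_less_1)
qed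

section \<open>Optional collection of further data\<close>

lemma confidence_level_first_only:
  assumes "G b = a"
  shows "confidence_level (\<lambda>h. normal2 (h, h)) {h. h \<le> 0} {x. b \<le> fst x} = a"
proof -
  have "{x. b \<le> x} \<in> sets borel"
    by measurable
  then have "measure (normal2 (h, h)) {x. b \<le> fst x} = measure (normal1 h) (UNIV - {..<b})" for h
    by (subst measure_normal2_marginal)
       (auto intro!: arg_cong[where f = "measure (normal1 h)"])
  then have "measure (normal2 (h, h)) {x. b \<le> fst x} = 1 - G (b - h)" for h
    using normal1.prob_compl[of "{..<b}" h] by (simp add: measure_normal1_lessThan)
  then show ?thesis
    using assms by (subst confidence_level_attained[of 0]) auto
qed

text \<open>
  The second look at the data is a second opportunity to reject, so under mean \<open>0\<close> the null
  hypothesis survives with probability \<open>a\<^sup>2\<close> only.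
\<close>

lemma confidence_level_either:
  assumes "G b = a"
  shows "confidence_level (\<lambda>h. normal2 (h, h)) {h. h \<le> 0} {x. b \<le> fst x \<or> b \<le> snd x} = a\<^sup>2"
proof -
  have "{x. b \<le> x} \<in> sets borel"
    by measurable
  then have *: "measure (normal2 (h, h)) {x. b \<le> fst x \<or> b \<le> snd x} = 1 - (G (b - h))\<^sup>2" for h
    using measure_normal1_lessThan[of h b]
    by (subst measure_normal2_either) (auto simp: not_le lessThan_def power2_eq_square)
  have "(G b)\<^sup>2 \<le> (G (b - h))\<^sup>2" if "h \<le> 0" for h
    using that by (intro power_mono) (auto simp: less_imp_le)
  then show ?thesis
    using assms by (subst confidence_level_attained[of 0]) (auto simp: *)
qed

section \<open>Tests on two systems: both alternatives\<close>

text \<open>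
  When one coordinate is tested, the other mean is arbitrary both under the null hypothesis and under the
  alternative. The least favourable null parameter for \<open>h\<close> replaces the tested mean by \<open>0\<close> and keeps the
  other one; the likelihood ratio then depends on the tested coordinate alone.
\<close>

lemma marginal_test:
  assumes \<pi>: "\<pi> \<in> {fst, snd}"
    and C: "\<And>\<eta>. \<eta> \<in> {0..1} \<Longrightarrow> C \<eta> = {x. \<eta> \<le> G (\<pi> x)}"
  shows "valid_nested_family UNIV normal2 {h. \<pi> h \<le> 0} C"
    and "uniformly_optimal_family UNIV normal2 {h. \<pi> h \<le> 0} C"
    and "frequentist_confidence C x = G (\<pi> x)"
proof -
  have [measurable]: "\<pi> \<in> borel_measurable (borel \<Otimes>\<^sub>M borel)"
    using \<pi> by auto
  have sets: "C \<eta> \<in> sets (normal2 h)" if \<eta>: "\<eta> \<in> {0..1}" for \<eta> h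
  proof -
    have "{x \<in> space (borel \<Otimes>\<^sub>M borel). \<eta> \<le> G (\<pi> x)} \<in> sets (borel \<Otimes>\<^sub>M borel)"
      by measurable
    then show ?thesis by (simp add: C[OF \<eta>] space_pair_measure)
  qed
  have meas: "measure (normal2 h) (C \<eta>) = measure (normal1 (\<pi> h)) {x. \<eta> \<le> G x}"
    if "\<eta> \<in> {0..1}" for \<eta> h
    using that \<pi> by (simp only: C) (rule measure_normal2_marginal, auto)
  show valid: "valid_nested_family UNIV normal2 {h. \<pi> h \<le> 0} C"
    using sets by (intro valid_nested_familyI) (auto simp: meas measure_normal1_G_null, auto simp: C)
  show "uniformly_optimal_family UNIV normal2 {h. \<pi> h \<le> 0} C"
    unfolding uniformly_optimal_family_def
  proof
    fix \<eta> :: real assume \<eta>: "\<eta> \<in> {0..1}"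
    show "uniformly_optimal UNIV normal2 {h. \<pi> h \<le> 0} \<eta> (C \<eta>)"
    proof (rule uniformly_optimal_neyman_pearson)
      show "critical_region UNIV normal2 {h. \<pi> h \<le> 0} \<eta> (C \<eta>)"
        using valid \<eta> by (simp add: valid_nested_family_def)
    next
      fix h assume h: "h \<in> UNIV - {h. \<pi> h \<le> 0}"
      let ?r = "\<lambda>x. normal_ratio (\<pi> h) 0 (\<pi> x)"
      obtain k where k: "\<pi> k = 0" and dens: "normal2 h = density (normal2 k) (\<lambda>x. ennreal (?r x))"
      proof
        let ?k = "if \<pi> = fst then (0, snd h) else (fst h, 0)"
        have "fst \<noteq> (snd :: real \<times> real \<Rightarrow> real)"
          by (metis fst_conv snd_conv zero_neq_one)
        then show "\<pi> ?k = 0" "normal2 h = density (normal2 ?k) (\<lambda>x. ennreal (?r x))"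
          using \<pi> normal2_eq_density[of h ?k] by auto
      qed
      have "?r y \<le> ?r x" if "x \<in> C \<eta>" "y \<notin> C \<eta>" for x y
      proof -
        have "G (\<pi> y) < G (\<pi> x)"
          using that \<eta> by (auto simp: C simp del: G_less_iff)
        then show ?thesis
          using h by (auto intro!: normal_ratio_mono)
      qed
      moreover have "measure (normal2 k) (C \<eta>) = 1 - \<eta>"
        using measure_normal1_G(3)[OF \<eta>, of 0] by (simp add: meas[OF \<eta>] k)
      ultimately show "\<exists>k\<in>{h. \<pi> h \<le> 0}. \<exists>r. r \<in> borel_measurable (normal2 k) \<and>
          normal2 h = density (normal2 k) (\<lambda>x. ennreal (r x)) \<and>
          (\<forall>x\<in>C \<eta>. \<forall>y\<in>space (normal2 k) - C \<eta>. r y \<le> r x) \<and>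
          measure (normal2 k) (C \<eta>) = 1 - \<eta>"
        using k dens by (intro bexI[of _ k] exI[of _ ?r]) auto
    qed (auto simp: prob_space_normal2)
  qed
  show "frequentist_confidence C x = G (\<pi> x)"
    by (rule frequentist_confidence_eqI) (auto simp: C less_imp_le)
qed

abbreviation not_both_positive :: "(real \<times> real) set" where
  "not_both_positive \<equiv> {(h1, h2). h1 \<le> 0 \<or> h2 \<le> 0}"

lemma G_shift_lim: "((\<lambda>t. G (c - t)) \<longlongrightarrow> 0) at_top"
proof (rule filterlim_compose[OF G_lim_bot])
  show "filterlim (\<lambda>t. c - t) at_bot at_top"
    by (simp add: filterlim_uminus_at_bot filterlim_tendsto_add_at_top[OF tendsto_const[of "- c"] filterlim_ident, simplified])
qed

text \<open>
  A monotone region contains the quadrant above each of its points. Letting one mean tend to infinity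
  turns the quadrant into a half-plane, whose size under mean \<open>0\<close> of the other coordinate is
  \<open>1 - G (fst x)\<close> or \<open>1 - G (snd x)\<close>. So the condition on the size bounds each coordinate separately, and the
  optimal region is optimal by inclusion.
\<close>

lemma monotone_region_subset:
  assumes A: "A \<in> monotone_regions" and crit: "critical_region UNIV normal2 not_both_positive \<eta> A"
  shows "A \<subseteq> {x. \<eta> \<le> G (fst x) \<and> \<eta> \<le> G (snd x)}"
proof
  fix x assume x: "x \<in> A"
  have bound: "(1 - G (fst x - fst h)) * (1 - G (snd x - snd h)) \<le> 1 - \<eta>"
    if "h \<in> not_both_positive" for h
  proof -
    have "{y. fst x \<le> fst y \<and> snd x \<le> snd y} \<subseteq> A"
      using A x by (auto simp: monotone_regions_def)
    then have "measure (normal2 h) {y. fst x \<le> fst y \<and> snd x \<le> snd y} \<le> measure (normal2 h) A"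
      using crit by (intro normal2.finite_measure_mono) (auto simp: critical_region_def)
    also have "\<dots> \<le> 1 - \<eta>"
      using crit that by (auto simp: critical_region_def)
    finally show ?thesis by (simp add: measure_normal2_quadrant)
  qed
  have "(1 - 0) * (1 - G (snd x)) \<le> 1 - \<eta>"
  proof (rule tendsto_upperbound)
    show "((\<lambda>t. (1 - G (fst x - t)) * (1 - G (snd x))) \<longlongrightarrow> (1 - 0) * (1 - G (snd x))) at_top"
      by (intro tendsto_intros G_shift_lim)
    show "\<forall>\<^sub>F t in at_top. (1 - G (fst x - t)) * (1 - G (snd x)) \<le> 1 - \<eta>"
      using bound[of "(t, 0)" for t] by simp
  qed simp
  moreover have "(1 - G (fst x)) * (1 - 0) \<le> 1 - \<eta>"
  proof (rule tendsto_upperbound)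
    show "((\<lambda>t. (1 - G (fst x)) * (1 - G (snd x - t))) \<longlongrightarrow> (1 - G (fst x)) * (1 - 0)) at_top"
      by (intro tendsto_intros G_shift_lim)
    show "\<forall>\<^sub>F t in at_top. (1 - G (fst x)) * (1 - G (snd x - t)) \<le> 1 - \<eta>"
      using bound[of "(0, t)" for t] by simp
  qed simp
  ultimately show "x \<in> {x. \<eta> \<le> G (fst x) \<and> \<eta> \<le> G (snd x)}"
    by simp
qed

text \<open>
  Under a null parameter one of the means is at most \<open>0\<close>, and the size of the marginal test on that
  coordinate already bounds the joint region: requiring both coordinates to be large costs no
  confidence beyond the smaller of the two.
\<close>

lemma conjunction_test:
  assumes J: "\<And>\<eta>. \<eta> \<in> {0..1} \<Longrightarrow> J \<eta> = {x. \<eta> \<le> G (fst x) \<and> \<eta> \<le> G (snd x)}"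
  shows "valid_nested_family UNIV normal2 not_both_positive J"
    and "\<And>\<eta>. \<eta> \<in> {0..1} \<Longrightarrow>
      uniformly_optimal_within monotone_regions UNIV normal2 not_both_positive \<eta> (J \<eta>)"
    and "frequentist_confidence J x = min (G (fst x)) (G (snd x))"
proof -
  have sets [measurable]: "{x. \<eta> \<le> G (\<pi> x)} \<in> sets (borel \<Otimes>\<^sub>M borel)"
    if "\<pi> \<in> {fst, snd}" for \<eta> and \<pi> :: "real \<times> real \<Rightarrow> real"
  proof -
    have "{x \<in> space (borel \<Otimes>\<^sub>M borel). \<eta> \<le> G (\<pi> x)} \<in> sets (borel \<Otimes>\<^sub>M borel)"
      using that by auto
    then show ?thesis by (simp add: space_pair_measure)
  qed
  show valid: "valid_nested_family UNIV normal2 not_both_positive J"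
  proof (rule valid_nested_familyI)
    fix \<eta> :: real and h assume \<eta>: "\<eta> \<in> {0..1}" and "h \<in> not_both_positive"
    then have "\<exists>\<pi>\<in>{fst, snd}. \<pi> h \<le> 0"
      by auto
    then obtain \<pi> where \<pi>: "\<pi> \<in> {fst, snd}" "\<pi> h \<le> 0"
      by blast
    have "measure (normal2 h) (J \<eta>) \<le> measure (normal2 h) {x. \<eta> \<le> G (\<pi> x)}"
      using \<pi>(1) sets by (intro normal2.finite_measure_mono) (auto simp: J[OF \<eta>])
    also have "\<dots> \<le> 1 - \<eta>"
      using measure_normal1_G_null(2)[OF \<eta> \<pi>(2)] \<pi>(1) by (subst measure_normal2_marginal) auto
    finally show "measure (normal2 h) (J \<eta>) \<le> 1 - \<eta>" .
  qed (use sets[of fst] sets[of snd] in \<open>auto simp: J Collect_conj_eq\<close>)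
  show "uniformly_optimal_within monotone_regions UNIV normal2 not_both_positive \<eta> (J \<eta>)"
    if \<eta>: "\<eta> \<in> {0..1}" for \<eta>
    unfolding uniformly_optimal_within_def
  proof (intro conjI ballI impI)
    show "J \<eta> \<in> monotone_regions"
      unfolding monotone_regions_def J[OF \<eta>] by (auto simp del: G_le_iff dest: G_le_iff[THEN iffD2])
    show crit: "critical_region UNIV normal2 not_both_positive \<eta> (J \<eta>)"
      using valid \<eta> by (simp add: valid_nested_family_def)
    fix A h
    assume "A \<in> monotone_regions" "critical_region UNIV normal2 not_both_positive \<eta> A"
    then have "A \<subseteq> J \<eta>"
      using monotone_region_subset by (simp add: J[OF \<eta>])
    then show "measure (normal2 h) A \<le> measure (normal2 h) (J \<eta>)"
      using crit by (intro normal2.finite_measure_mono) (auto simp: critical_region_def)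
  qed
  show "frequentist_confidence J x = min (G (fst x)) (G (snd x))"
    by (rule frequentist_confidence_eqI) (auto simp: J less_imp_le min_le_iff_disj)
qed

lemma quadrant_power_lim:
  "((\<lambda>h. measure (normal2 h) {x. b \<le> fst x \<and> b \<le> snd x}) \<longlongrightarrow> 1 - G b) (at_top \<times>\<^sub>F nhds 0)"
proof -
  have "((\<lambda>h. G (b - snd h)) \<longlongrightarrow> G (b - 0)) (at_top \<times>\<^sub>F nhds (0::real))"
    by (intro isCont_tendsto_compose[OF isCont_G] tendsto_intros filterlim_snd)
  moreover have "((\<lambda>h. G (b - fst h)) \<longlongrightarrow> 0) (at_top \<times>\<^sub>F nhds (0::real))"
    by (rule filterlim_compose[OF G_shift_lim filterlim_fst])
  ultimately have "((\<lambda>h. (1 - G (b - fst h)) * (1 - G (b - snd h))) \<longlongrightarrow> (1 - 0) * (1 - G (b - 0)))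
      (at_top \<times>\<^sub>F nhds (0::real))"
    by (intro tendsto_intros)
  then show ?thesis
    by (simp add: measure_normal2_quadrant)
qed

text \<open>
  The supremum is not attained: it is approached along the parameters \<open>(t, 0)\<close> as \<open>t\<close> tends to
  infinity, where the condition on the first coordinate is met almost surely.
\<close>

lemma SUP_quadrant:
  "(SUP h\<in>not_both_positive. measure (normal2 h) {x. b \<le> fst x \<and> b \<le> snd x}) = 1 - G b"
proof (rule antisym)
  let ?C = "{x. b \<le> fst x \<and> b \<le> snd x}"
  define J where "J \<eta> = {x. \<eta> \<le> G (fst x) \<and> \<eta> \<le> G (snd x)}" for \<eta>
  have "valid_nested_family UNIV normal2 not_both_positive J"
    by (rule conjunction_test) (simp add: J_def)
  moreover have "J (G b) = ?C"
    by (simp add: J_def)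
  moreover have "G b \<in> {0..1}"
    by (simp add: less_imp_le)
  ultimately have "critical_region UNIV normal2 not_both_positive (G b) ?C"
    unfolding valid_nested_family_def by metis
  then have "measure (normal2 h) ?C \<le> 1 - G b" if "h \<in> not_both_positive" for h
    using that unfolding critical_region_def by blast
  moreover have "not_both_positive \<noteq> {}"
    by auto
  ultimately show "(SUP h\<in>not_both_positive. measure (normal2 h) ?C) \<le> 1 - G b"
    by (intro cSUP_least) auto
  have "(1 - 0) * (1 - G b) \<le> (SUP h\<in>not_both_positive. measure (normal2 h) ?C)"
  proof (rule tendsto_upperbound)
    show "((\<lambda>t. (1 - G (b - t)) * (1 - G b)) \<longlongrightarrow> (1 - 0) * (1 - G b)) at_top"
      by (intro tendsto_intros G_shift_lim)
    have "(1 - G (b - t)) * (1 - G b) \<le> (SUP h\<in>not_both_positive. measure (normal2 h) ?C)" for t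
    proof -
      have "(1 - G (b - t)) * (1 - G b) = measure (normal2 (t, 0)) ?C"
        by (simp add: measure_normal2_quadrant)
      also have "\<dots> \<le> (SUP h\<in>not_both_positive. measure (normal2 h) ?C)"
        by (intro cSUP_upper bdd_above_measure prob_space_normal2) auto
      finally show ?thesis .
    qed
    then show "\<forall>\<^sub>F t in at_top. (1 - G (b - t)) * (1 - G b) \<le>
        (SUP h\<in>not_both_positive. measure (normal2 h) ?C)"
      by simp
  qed simp
  then show "1 - G b \<le> (SUP h\<in>not_both_positive. measure (normal2 h) ?C)"
    by simp
qed

lemma confidence_level_antimono:
  assumes prob: "\<And>h. h \<in> H0 \<Longrightarrow> prob_space (P h)" and "H0 \<noteq> {}"
    and "C \<subseteq> D" and sets: "\<And>h. h \<in> H0 \<Longrightarrow> D \<in> sets (P h)"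
  shows "confidence_level P H0 D \<le> confidence_level P H0 C"
proof -
  have "measure (P h) C \<le> measure (P h) D" if "h \<in> H0" for h
  proof -
    interpret prob_space "P h" using prob that .
    show ?thesis using \<open>C \<subseteq> D\<close> sets[OF that] by (rule finite_measure_mono)
  qed
  then have "(SUP h\<in>H0. measure (P h) C) \<le> (SUP h\<in>H0. measure (P h) D)"
    using assms by (intro cSUP_subset_mono bdd_above_measure) auto
  then show ?thesis
    by (simp add: confidence_level_def)
qed

section \<open>Tests on two systems: at least one alternative\<close>

lemma marginal_strict_test:
  assumes \<pi>: "\<pi> \<in> {fst, snd}"
    and C: "\<And>\<eta>. \<eta> \<in> {0..1} \<Longrightarrow> C \<eta> = {x. \<eta> < G (\<pi> x)}"
  shows "valid_nested_family UNIV normal2 {h. \<pi> h \<le> 0} C"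
    and "frequentist_confidence C x = G (\<pi> x)"
proof -
  have [measurable]: "\<pi> \<in> borel_measurable (borel \<Otimes>\<^sub>M borel)"
    using \<pi> by auto
  have sets: "C \<eta> \<in> sets (normal2 h)" if \<eta>: "\<eta> \<in> {0..1}" for \<eta> h
  proof -
    have "{x \<in> space (borel \<Otimes>\<^sub>M borel). \<eta> < G (\<pi> x)} \<in> sets (borel \<Otimes>\<^sub>M borel)"
      by measurable
    then show ?thesis by (simp add: C[OF \<eta>] space_pair_measure)
  qed
  have meas: "measure (normal2 h) (C \<eta>) = measure (normal1 (\<pi> h)) {x. \<eta> < G x}"
    if "\<eta> \<in> {0..1}" for \<eta> h
    using that \<pi> by (simp only: C) (rule measure_normal2_marginal, auto)
  show "valid_nested_family UNIV normal2 {h. \<pi> h \<le> 0} C"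
    using sets by (intro valid_nested_familyI) (auto simp: meas measure_normal1_G_null, auto simp: C)
  show "frequentist_confidence C x = G (\<pi> x)"
    by (rule frequentist_confidence_eqI) (auto simp: C less_imp_le)
qed

abbreviation both_nonpositive :: "(real \<times> real) set" where
  "both_nonpositive \<equiv> {(h1, h2). h1 \<le> 0 \<and> h2 \<le> 0}"

text \<open>
  The complement is a product of half-lines, each of probability at least \<open>p\<close> under the null
  hypothesis, with equality if both means are \<open>0\<close>. Hence the square.
\<close>

lemma measure_disjunction:
  assumes "p \<in> {0..1}"
  shows "h \<in> both_nonpositive \<Longrightarrow> measure (normal2 h) {x. p < G (fst x) \<or> p < G (snd x)} \<le> 1 - p\<^sup>2"
    and "measure (normal2 0) {x. p < G (fst x) \<or> p < G (snd x)} = 1 - p\<^sup>2"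
proof -
  have *: "measure (normal2 h) {x. p < G (fst x) \<or> p < G (snd x)} =
      1 - measure (normal1 (fst h)) {x. G x \<le> p} * measure (normal1 (snd h)) {x. G x \<le> p}" for h
    by (subst measure_normal2_either) (auto simp: not_less)
  show "measure (normal2 h) {x. p < G (fst x) \<or> p < G (snd x)} \<le> 1 - p\<^sup>2"
    if "h \<in> both_nonpositive"
    unfolding * power2_eq_square using that assms
    by (auto intro!: mult_mono measure_normal1_G_null)
  show "measure (normal2 0) {x. p < G (fst x) \<or> p < G (snd x)} = 1 - p\<^sup>2"
    unfolding * power2_eq_square using measure_normal1_G(2)[OF assms, of 0] by simp
qed

text \<open>
  The region with marginal level \<open>p\<close> has joint level \<open>p\<^sup>2\<close>; indexed by its joint level \<open>z\<close>, the
  marginal level is \<open>sqrt z\<close>.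
\<close>

lemma disjunction_test:
  assumes D: "\<And>z. z \<in> {0..1} \<Longrightarrow> D z = {x. sqrt z < G (fst x) \<or> sqrt z < G (snd x)}"
  shows "valid_nested_family UNIV normal2 both_nonpositive D"
    and "frequentist_confidence D x = (max (G (fst x)) (G (snd x)))\<^sup>2"
proof -
  show "valid_nested_family UNIV normal2 both_nonpositive D"
  proof (rule valid_nested_familyI)
    fix z :: real and h assume z: "z \<in> {0..1}"
    have "{x \<in> space (borel \<Otimes>\<^sub>M borel). sqrt z < G (fst x) \<or> sqrt z < G (snd x)}
        \<in> sets (borel \<Otimes>\<^sub>M borel)"
      by measurable
    then show "D z \<in> sets (normal2 h)"
      by (simp add: D[OF z] space_pair_measure)
    show "measure (normal2 h) (D z) \<le> 1 - z" if "h \<in> both_nonpositive"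
      using measure_disjunction(1)[of "sqrt z" h] that z by (simp add: D)
  next
    fix z z' :: real and x assume "z \<in> {0..1}" "z' \<in> {0..1}" "z \<le> z'" "x \<in> D z'"
    moreover from this have "sqrt z \<le> sqrt z'" by simp
    ultimately show "x \<in> D z"
      by (auto simp: D simp del: real_sqrt_le_iff)
  qed
  let ?v = "max (G (fst x)) (G (snd x))"
  have v: "0 \<le> ?v" "?v \<le> 1"
    by (auto simp: max_def less_imp_le)
  have "x \<in> D z \<longleftrightarrow> z < ?v\<^sup>2" if "z \<in> {0..1}" for z
  proof -
    have "x \<in> D z \<longleftrightarrow> sqrt z < ?v"
      using that by (auto simp: D)
    also have "\<dots> \<longleftrightarrow> sqrt z < sqrt (?v\<^sup>2)"
      using v by simp
    also have "\<dots> \<longleftrightarrow> z < ?v\<^sup>2"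
      by (simp only: real_sqrt_less_iff)
    finally show ?thesis .
  qed
  then show "frequentist_confidence D x = ?v\<^sup>2"
    using v by (intro frequentist_confidence_eqI) (auto simp: power_le_one less_imp_le)
qed

section \<open>The five criteria\<close>

theorem mainTheorem3:
  fixes \<alpha> \<beta> :: real
  assumes alpha: "\<alpha> = 0.975"
    and beta: "ereal \<beta> = G_inv \<alpha>"
  shows "
     \<comment> \<open>numerical value of the constant\<close>
     (\<bar>\<beta> - 1.96\<bar> < 0.005) \<and>
     \<comment> \<open>Complementarity\<close>
     (let \<Theta> = {-\<beta>, \<beta>};
          C = (\<lambda>\<eta>. {x. G_inv \<eta> - ereal \<beta> \<le> ereal x});
          C' = (\<lambda>\<eta>. {x. ereal x \<le> G_inv (1 - \<eta>) + ereal \<beta>})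
      in \<Theta> - {-\<beta>} = {\<beta>} \<and> \<Theta> - {\<beta>} = {-\<beta>} \<and>
         valid_nested_family \<Theta> normal1 {-\<beta>} C \<and>
         uniformly_optimal_family \<Theta> normal1 {-\<beta>} C \<and>
         valid_nested_family \<Theta> normal1 {\<beta>} C' \<and>
         uniformly_optimal_family \<Theta> normal1 {\<beta>} C' \<and>
         frequentist_confidence C 0 = \<alpha> \<and>
         frequentist_confidence C' 0 = \<alpha> \<and>
         \<not> frequentist_confidence C' 0 \<le> 1 - frequentist_confidence C 0) \<and>
     \<comment> \<open>Inclusion\<close>
     (let H0 = {h. h \<le> 0}; H0' = {0};
          C = (\<lambda>\<eta>. {x. G_inv \<eta> \<le> ereal x});
          C' = (\<lambda>\<eta>. {x. ereal x \<le> G_inv ((1 - \<eta>) / 2)} \<union>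
                    {x. G_inv (1 - (1 - \<eta>) / 2) \<le> ereal x})
      in UNIV - H0 \<subset> UNIV - H0' \<and>
         valid_nested_family UNIV normal1 H0 C \<and>
         valid_nested_family UNIV normal1 H0' C' \<and>
         frequentist_confidence C \<beta> = \<alpha> \<and>
         frequentist_confidence C' \<beta> = 0.95 \<and>
         frequentist_confidence C' \<beta> < frequentist_confidence C \<beta>) \<and>
     \<comment> \<open>Intention\<close>
     (let P = (\<lambda>h. normal2 (h, h)); H0 = {h. h \<le> 0};
          R = {x. concludes_D \<beta> (data_D x)};
          R' = {x. concludes_D' \<beta> (data_D' \<beta> x)};
          C = single_region_family P H0 R;
          C' = single_region_family P H0 R'
      in R = {(x1, x2). x1 \<ge> \<beta>} \<and>
         R' = {(x1, x2). x1 \<ge> \<beta> \<or> (x1 < \<beta> \<and> x2 \<ge> \<beta>)} \<and>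
         confidence_level P H0 R = \<alpha> \<and>
         confidence_level P H0 R' = 1 - (1 - \<alpha> + \<alpha> * (1 - \<alpha>)) \<and>
         \<bar>confidence_level P H0 R' - 0.9506\<bar> < 0.00005 \<and>
         confidence_level P H0 R' < \<alpha> \<and>
         valid_nested_family UNIV P H0 C \<and>
         valid_nested_family UNIV P H0 C' \<and>
         (\<forall>x2. data_D (\<beta>, x2) = [\<beta>] \<and> data_D' \<beta> (\<beta>, x2) = [\<beta>] \<and>
            frequentist_confidence C (\<beta>, x2) = \<alpha> \<and>
            frequentist_confidence C' (\<beta>, x2) = 1 - (1 - \<alpha> + \<alpha> * (1 - \<alpha>)) \<and>
            frequentist_confidence C (\<beta>, x2) \<noteq> frequentist_confidence C' (\<beta>, x2))) \<and>
     \<comment> \<open>Conjunction\<close>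
     (let S = (\<lambda>(\<pi> :: real \<times> real \<Rightarrow> real) \<eta>. {x. G_inv \<eta> \<le> ereal (\<pi> x)});
          H0 = {(h1, h2). h1 \<le> 0 \<or> h2 \<le> 0};
          C = {(x1, x2). x1 \<ge> \<beta> \<and> x2 \<ge> \<beta>};
          J = (\<lambda>\<eta>. S fst \<eta> \<inter> S snd \<eta>)
      in (\<forall>\<pi>\<in>{fst, snd}.
            valid_nested_family UNIV normal2 {h. \<pi> h \<le> 0} (S \<pi>) \<and>
            uniformly_optimal_family UNIV normal2 {h. \<pi> h \<le> 0} (S \<pi>) \<and>
            frequentist_confidence (S \<pi>) (\<beta>, \<beta>) = \<alpha>) \<and>
         UNIV - H0 = {(h1, h2). h1 > 0 \<and> h2 > 0} \<and>
         C = J \<alpha> \<and> (\<beta>, \<beta>) \<in> C \<and>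
         uniformly_optimal_within monotone_regions UNIV normal2 H0 \<alpha> C \<and>
         (\<forall>\<eta>\<in>{0..1}. \<forall>C'.
            uniformly_optimal_within monotone_regions UNIV normal2 H0 \<eta> C' \<and> (\<beta>, \<beta>) \<in> C'
            \<longrightarrow> confidence_level normal2 H0 C' \<le> confidence_level normal2 H0 C) \<and>
         ((\<lambda>h. measure (normal2 h) C) \<longlongrightarrow> (SUP h\<in>H0. measure (normal2 h) C))
            (inf (at_top \<times>\<^sub>F nhds 0) (principal H0)) \<and>
         (SUP h\<in>H0. measure (normal2 h) C) = 1 - \<alpha> \<and>
         confidence_level normal2 H0 C = \<alpha> \<and>
         valid_nested_family UNIV normal2 H0 J \<and>
         (\<forall>\<eta>\<in>{0..1}. uniformly_optimal_within monotone_regions UNIV normal2 H0 \<eta> (J \<eta>)) \<and>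
         frequentist_confidence J (\<beta>, \<beta>) = \<alpha> \<and>
         (\<forall>\<pi>\<in>{fst, snd}.
            \<not> frequentist_confidence J (\<beta>, \<beta>) < frequentist_confidence (S \<pi>) (\<beta>, \<beta>))) \<and>
     \<comment> \<open>Disjunction\<close>
     (let S = (\<lambda>(\<pi> :: real \<times> real \<Rightarrow> real) \<eta>. {x. G_inv \<eta> < ereal (\<pi> x)});
          H0 = {(h1, h2). h1 \<le> 0 \<and> h2 \<le> 0};
          R = (\<lambda>\<eta>. {(x1, x2). G_inv \<eta> < ereal x1 \<or> G_inv \<eta> < ereal x2});
          \<zeta> = (\<lambda>\<eta>. confidence_level normal2 H0 (R \<eta>));
          D = (\<lambda>z. R (sqrt z))
      in (\<forall>\<pi>\<in>{fst, snd}.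
            valid_nested_family UNIV normal2 {h. \<pi> h \<le> 0} (S \<pi>) \<and>
            frequentist_confidence (S \<pi>) (\<beta>, \<beta>) = \<alpha>) \<and>
         UNIV - H0 = {(h1, h2). h1 > 0 \<or> h2 > 0} \<and>
         (\<forall>\<eta>\<in>{0..1}. \<zeta> \<eta> = \<eta>\<^sup>2 \<and> D (\<zeta> \<eta>) = R \<eta>) \<and>
         valid_nested_family UNIV normal2 H0 D \<and>
         frequentist_confidence D (\<beta>, \<beta>) = \<alpha>\<^sup>2 \<and>
         \<alpha>\<^sup>2 < \<alpha> \<and>
         (\<forall>\<pi>\<in>{fst, snd}.
            \<not> frequentist_confidence D (\<beta>, \<beta>) > frequentist_confidence (S \<pi>) (\<beta>, \<beta>)))"
proof -
  have G_\<beta>: "G \<beta> = \<alpha>"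
  proof -
    have "\<alpha> \<in> {0..1}" using alpha by simp
    then show ?thesis
    proof (cases \<alpha> rule: G_inv_cases)
      case (inner z)
      from inner(2) have "\<beta> = z" by (simp flip: beta)
      with inner(1) show ?thesis by simp
    qed (use alpha in simp_all)
  qed
  have \<beta>_pos: "0 < \<beta>"
  proof -
    have "G 0 < G \<beta>" using alpha by (simp add: G_\<beta> G_0 del: G_less_iff)
    then show ?thesis by simp
  qed
  have either_level: "1 - (1 - \<alpha> + \<alpha> * (1 - \<alpha>)) = \<alpha>\<^sup>2"
    by (simp add: power2_eq_square algebra_simps)
  show ?thesis
  proof (intro conjI, goal_cases)
    case 1
    show ?case using quantile_bounds G_\<beta> alpha by simp
  next
    case 2
    let ?C = "\<lambda>\<eta>. {x. G_inv \<eta> - ereal \<beta> \<le> ereal x}"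
    let ?C' = "\<lambda>\<eta>. {x. ereal x \<le> G_inv (1 - \<eta>) + ereal \<beta>}"
    have C: "valid_nested_family {- \<beta>, \<beta>} normal1 {- 1 * \<beta>} ?C"
      "uniformly_optimal_family {- \<beta>, \<beta>} normal1 {- 1 * \<beta>} ?C"
      "frequentist_confidence ?C 0 = G \<beta>"
      by (rule two_point_test[OF \<beta>_pos, where s = 1]; simp add: G_inv_minus_le_iff)+
    have C': "valid_nested_family {- \<beta>, \<beta>} normal1 {- (-1) * \<beta>} ?C'"
      "uniformly_optimal_family {- \<beta>, \<beta>} normal1 {- (-1) * \<beta>} ?C'"
      "frequentist_confidence ?C' 0 = G \<beta>"
      by (rule two_point_test[OF \<beta>_pos, where s = "-1"]; simp add: le_G_inv_plus_iff)+
    show ?case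
      unfolding Let_def using C C' \<beta>_pos alpha G_\<beta> by auto
  next
    case 3
    let ?C = "\<lambda>\<eta>. {x. G_inv \<eta> \<le> ereal x}"
    let ?C' = "\<lambda>\<eta>. {x. ereal x \<le> G_inv ((1 - \<eta>) / 2)} \<union> {x. G_inv (1 - (1 - \<eta>) / 2) \<le> ereal x}"
    have C: "valid_nested_family UNIV normal1 {h. h \<le> 0} ?C" "frequentist_confidence ?C \<beta> = G \<beta>"
      by (rule one_sided_test; simp add: G_inv_le_iff)+
    have C': "valid_nested_family UNIV normal1 {0} ?C'"
      "frequentist_confidence ?C' \<beta> = \<bar>2 * G \<beta> - 1\<bar>"
      by (rule two_sided_test; simp add: G_inv_le_iff le_G_inv_iff)+
    have "UNIV - {h. h \<le> 0} \<subset> UNIV - {0 :: real}"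
    proof
      have "- 1 \<in> UNIV - {0 :: real}" "- 1 \<notin> UNIV - {h :: real. h \<le> 0}" by simp_all
      then show "UNIV - {h. h \<le> 0} \<noteq> UNIV - {0 :: real}" by blast
    qed auto
    then show ?case
      unfolding Let_def using C C' alpha G_\<beta> by simp
  next
    case 4
    let ?P = "\<lambda>h. normal2 (h, h)"
    have R: "{x. concludes_D \<beta> (data_D x)} = {x. \<beta> \<le> fst x}"
      by (simp add: concludes_D_def data_D_def)
    have R': "{x. concludes_D' \<beta> (data_D' \<beta> x)} = {x. \<beta> \<le> fst x \<or> \<beta> \<le> snd x}"
      by (auto simp: concludes_D'_def data_D'_def)
    have [measurable]: "{x. \<beta> \<le> fst x} \<in> sets (borel \<Otimes>\<^sub>M borel)"
      "{x. \<beta> \<le> fst x \<or> \<beta> \<le> snd x} \<in> sets (borel \<Otimes>\<^sub>M borel)"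
    proof -
      have "{x \<in> space (borel \<Otimes>\<^sub>M borel). \<beta> \<le> fst x} \<in> sets (borel \<Otimes>\<^sub>M borel)"
        "{x \<in> space (borel \<Otimes>\<^sub>M borel). \<beta> \<le> fst x \<or> \<beta> \<le> snd x} \<in> sets (borel \<Otimes>\<^sub>M borel)"
        by measurable
      then show "{x. \<beta> \<le> fst x} \<in> sets (borel \<Otimes>\<^sub>M borel)"
        "{x. \<beta> \<le> fst x \<or> \<beta> \<le> snd x} \<in> sets (borel \<Otimes>\<^sub>M borel)"
        by (simp_all add: space_pair_measure)
    qed
    have valid: "valid_nested_family UNIV ?P {h. h \<le> 0} (single_region_family ?P {h. h \<le> 0} {x. \<beta> \<le> fst x})"
      "valid_nested_family UNIV ?P {h. h \<le> 0}
        (single_region_family ?P {h. h \<le> 0} {x. \<beta> \<le> fst x \<or> \<beta> \<le> snd x})"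
      by (rule valid_single_region_family; simp add: prob_space_normal2)+
    have level: "confidence_level ?P {h. h \<le> 0} {x. \<beta> \<le> fst x} = \<alpha>"
      "confidence_level ?P {h. h \<le> 0} {x. \<beta> \<le> fst x \<or> \<beta> \<le> snd x} = \<alpha>\<^sup>2"
      using confidence_level_first_only confidence_level_either G_\<beta> by blast+
    have conf: "frequentist_confidence (single_region_family ?P {h. h \<le> 0} {x. \<beta> \<le> fst x}) (\<beta>, x2) = \<alpha>"
      "frequentist_confidence
        (single_region_family ?P {h. h \<le> 0} {x. \<beta> \<le> fst x \<or> \<beta> \<le> snd x}) (\<beta>, x2) = \<alpha>\<^sup>2" for x2
      by (subst frequentist_confidence_single_region; simp add: level alpha power2_eq_square)+
    have num: "\<bar>\<alpha>\<^sup>2 - 0.9506\<bar> < 0.00005" "\<alpha>\<^sup>2 < \<alpha>"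
      by (simp_all add: alpha power2_eq_square)
    show ?case
      unfolding Let_def R R' either_level using valid level conf num
      by (auto simp: data_D_def data_D'_def)
  next
    case 5
    let ?S = "\<lambda>(\<pi> :: real \<times> real \<Rightarrow> real) \<eta>. {x. G_inv \<eta> \<le> ereal (\<pi> x)}"
    let ?J = "\<lambda>\<eta>. ?S fst \<eta> \<inter> ?S snd \<eta>"
    let ?C = "{(x1, x2). x1 \<ge> \<beta> \<and> x2 \<ge> \<beta>}"
    have C_eq: "?C = {x. \<beta> \<le> fst x \<and> \<beta> \<le> snd x}"
      by auto
    have \<alpha>: "\<alpha> \<in> {0..1}" using alpha by simp
    have S: "valid_nested_family UNIV normal2 {h. \<pi> h \<le> 0} (?S \<pi>)"
      "uniformly_optimal_family UNIV normal2 {h. \<pi> h \<le> 0} (?S \<pi>)"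
      "frequentist_confidence (?S \<pi>) x = G (\<pi> x)" if "\<pi> \<in> {fst, snd}" for \<pi> x
      by (rule marginal_test[OF that]; simp add: G_inv_le_iff)+
    have J: "valid_nested_family UNIV normal2 not_both_positive ?J"
      "\<And>\<eta>. \<eta> \<in> {0..1} \<Longrightarrow> uniformly_optimal_within monotone_regions UNIV normal2 not_both_positive \<eta> (?J \<eta>)"
      "frequentist_confidence ?J x = min (G (fst x)) (G (snd x))" for x
      by (rule conjunction_test; auto simp: G_inv_le_iff)+
    have CJ: "?C = ?J \<alpha>"
      using \<alpha> by (auto simp: G_inv_le_iff G_\<beta>[symmetric])
    have opt: "uniformly_optimal_within monotone_regions UNIV normal2 not_both_positive \<alpha> ?C"
      unfolding CJ using \<alpha> by (rule J)
    \<comment> \<open>A monotone region containing the observation contains the quadrant above it, and larger regions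
      have smaller levels.\<close>
    have max: "confidence_level normal2 not_both_positive A \<le> confidence_level normal2 not_both_positive ?C"
      if "uniformly_optimal_within monotone_regions UNIV normal2 not_both_positive \<eta> A \<and> (\<beta>, \<beta>) \<in> A" for \<eta> A
    proof (rule confidence_level_antimono)
      show "?C \<subseteq> A"
        using that by (force simp: uniformly_optimal_within_def monotone_regions_def)
      show "A \<in> sets (normal2 h)" for h
        using that by (auto simp: uniformly_optimal_within_def critical_region_def)
    qed (auto simp: prob_space_normal2)
    have SUP: "(SUP h\<in>not_both_positive. measure (normal2 h) ?C) = 1 - \<alpha>"
      by (simp only: C_eq SUP_quadrant G_\<beta>)
    have lim: "((\<lambda>h. measure (normal2 h) ?C) \<longlongrightarrow> 1 - \<alpha>)
        (inf (at_top \<times>\<^sub>F nhds 0) (principal not_both_positive))"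
      using quadrant_power_lim[of \<beta>] unfolding C_eq G_\<beta>
      by (rule tendsto_mono[rotated]) simp
    have alt: "UNIV - not_both_positive = {(h1, h2). h1 > 0 \<and> h2 > 0}"
      by auto
    have mem: "(\<beta>, \<beta>) \<in> ?C" by simp
    have level: "confidence_level normal2 not_both_positive ?C = \<alpha>"
      by (simp only: confidence_level_def SUP)
    have conf_S: "frequentist_confidence (?S \<pi>) (\<beta>, \<beta>) = \<alpha>" if "\<pi> \<in> {fst, snd}" for \<pi>
      using S(3)[OF that, of "(\<beta>, \<beta>)"] that G_\<beta> by auto
    have conf_J: "frequentist_confidence ?J (\<beta>, \<beta>) = \<alpha>"
      by (simp only: J(3) G_\<beta> fst_conv snd_conv min.idem)
    have not_less: "\<not> frequentist_confidence ?J (\<beta>, \<beta>) < frequentist_confidence (?S \<pi>) (\<beta>, \<beta>)"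
      if "\<pi> \<in> {fst, snd}" for \<pi>
      by (simp only: conf_J conf_S[OF that] less_irrefl not_False_eq_True)
    show ?case
      unfolding Let_def SUP
      by (intro conjI ballI allI impI;
        rule S(1,2) conf_S J(1,2) conf_J CJ opt max lim alt mem level not_less refl; assumption)
  next
    case 6
    let ?S = "\<lambda>(\<pi> :: real \<times> real \<Rightarrow> real) \<eta>. {x. G_inv \<eta> < ereal (\<pi> x)}"
    let ?R = "\<lambda>\<eta>. {(x1, x2). G_inv \<eta> < ereal x1 \<or> G_inv \<eta> < ereal x2}"
    have S: "valid_nested_family UNIV normal2 {h. \<pi> h \<le> 0} (?S \<pi>)"
      "frequentist_confidence (?S \<pi>) x = G (\<pi> x)" if "\<pi> \<in> {fst, snd}" for \<pi> x
      by (rule marginal_strict_test[OF that]; simp add: G_inv_less_iff)+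
    have D: "valid_nested_family UNIV normal2 both_nonpositive (\<lambda>z. ?R (sqrt z))"
      "frequentist_confidence (\<lambda>z. ?R (sqrt z)) x = (max (G (fst x)) (G (snd x)))\<^sup>2" for x
      by (rule disjunction_test; auto simp: G_inv_less_iff)+
    have level: "confidence_level normal2 both_nonpositive (?R \<eta>) = \<eta>\<^sup>2" if \<eta>: "\<eta> \<in> {0..1}" for \<eta>
    proof -
      have R: "?R \<eta> = {x. \<eta> < G (fst x) \<or> \<eta> < G (snd x)}"
        using \<eta> by (auto simp: G_inv_less_iff)
      have "confidence_level normal2 both_nonpositive (?R \<eta>) = 1 - measure (normal2 0) (?R \<eta>)"
        unfolding R using measure_disjunction[OF \<eta>]
        by (intro confidence_level_attained) (auto simp: zero_prod_def)
      then show ?thesis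
        unfolding R measure_disjunction(2)[OF \<eta>] by simp
    qed
    have D_level: "?R (sqrt (\<eta>\<^sup>2)) = ?R \<eta>" if "\<eta> \<in> {0..1}" for \<eta>
      using that by simp
    have alt: "UNIV - both_nonpositive = {(h1, h2). h1 > 0 \<or> h2 > 0}"
      by auto
    have less: "\<alpha>\<^sup>2 < \<alpha>"
      by (simp add: alpha power2_eq_square)
    have conf_S: "frequentist_confidence (?S \<pi>) (\<beta>, \<beta>) = \<alpha>" if "\<pi> \<in> {fst, snd}" for \<pi>
      using S(2)[OF that, of "(\<beta>, \<beta>)"] that G_\<beta> by auto
    have conf_D: "frequentist_confidence (\<lambda>z. ?R (sqrt z)) (\<beta>, \<beta>) = \<alpha>\<^sup>2"
      by (simp only: D(2) G_\<beta> fst_conv snd_conv max.idem)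
    have D_level': "?R (sqrt (confidence_level normal2 both_nonpositive (?R \<eta>))) = ?R \<eta>"
      if "\<eta> \<in> {0..1}" for \<eta>
      using that by (simp only: level D_level)
    have not_less: "\<not> frequentist_confidence (?S \<pi>) (\<beta>, \<beta>) < frequentist_confidence (\<lambda>z. ?R (sqrt z)) (\<beta>, \<beta>)"
      if "\<pi> \<in> {fst, snd}" for \<pi>
      using less by (simp only: conf_D conf_S[OF that] not_less less_imp_le)
    show ?case
      unfolding Let_def
      by (intro conjI ballI allI impI;
        rule S(1) conf_S D(1) conf_D level D_level' alt less not_less; assumption)
  qed
qed

end
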